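(* Let $\omega\in\widehat{\mathcal{D}}$. Then the following statements are equivalent: (i) $T(D^1_\omega,H^\infty)$ consists of constant functions only; (ii) $\displaystyle\sup_{0\le r<1}\frac{1-r}{\widehat\omega(r)}=\infty$; (iii) $\displaystyle\sup_{0\le r<1}\left((1-r)\sum_{k=1}^\infty\frac{r^k}{(k+1)\omega_k}\right)=\infty$; (iv) the identity map $I:D^1_\omega\to D^1_0$ is not bounded.
   Context: $\mathbb{D}$ is the open unit disc, $\mathcal{H}(\mathbb{D})$ the analytic functions on it, $dA(z)=\frac{dx\,dy}{\pi}$. A radial weight is a non-negative $\omega\in L^1([0,1))$ extended by $\omega(z)=\omega(|z|)$; always assume $\widehat\omega(r)=\int_r^1\omega(s)\,ds>0$ for all $0\le r<1$. $\omega\in\widehat{\mathcal{D}}$ means there is $C\ge1$ with $\widehat\omega(r)\le C\widehat\omega(\frac{1+r}{2})$ for all $0\le r<1$. Moments: $\omega_x=\int_0^1 r^x\omega(r)\,dr$. $D^1_\omega$ consists of $f\in\mathcal H(\mathbb D)$ with $\|f\|_{D^1_\omega}=\int_{\mathbb D}|f'|\omega\,dA+|f(0)|<\infty$; $D^1_0$ is the case $\omega\equiv1$. For $g\in\mathcal H(\mathbb D)$, $T_g(f)(z)=\int_0^z f(\zeta)g'(\zeta)\,d\zeta$. $T(X,H^\infty)$ is the set of $g\in\mathcal H(\mathbb D)$ such that $T_g:X\to H^\infty$ is bounded. *)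

theory Defs
  imports "HOL-Complex_Analysis.Complex_Analysis"
begin

definition omega_hat :: "(real \<Rightarrow> real) \<Rightarrow> real \<Rightarrow> real" where
  "omega_hat \<omega> r = (LINT s:{r..<1}|lborel. \<omega> s)"

definition radial_weight :: "(real \<Rightarrow> real) \<Rightarrow> bool" where
  "radial_weight \<omega> \<longleftrightarrow> (\<forall>r\<in>{0..<1}. 0 \<le> \<omega> r) \<and> set_integrable lborel {0..<1} \<omega>
     \<and> (\<forall>r\<in>{0..<1}. 0 < omega_hat \<omega> r)"

definition D_hat :: "(real \<Rightarrow> real) \<Rightarrow> bool" where
  "D_hat \<omega> \<longleftrightarrow> (\<exists>C\<ge>1. \<forall>r\<in>{0..<1}. omega_hat \<omega> r \<le> C * omega_hat \<omega> ((1 + r) / 2))"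

definition moment :: "(real \<Rightarrow> real) \<Rightarrow> nat \<Rightarrow> real" where
  "moment \<omega> k = (LINT r:{0..<1}|lborel. r ^ k * \<omega> r)"

text \<open>The D^1_\<omega> norm (with dA = dx dy / \<pi>), valued in [0,\<infinity>].\<close>
definition D1_norm :: "(real \<Rightarrow> real) \<Rightarrow> (complex \<Rightarrow> complex) \<Rightarrow> ennreal" where
  "D1_norm \<omega> f = (\<integral>\<^sup>+ z\<in>ball 0 1. ennreal (norm (deriv f z) * \<omega> (cmod z) / pi) \<partial>lborel)
      + ennreal (norm (f 0))"

definition D1 :: "(real \<Rightarrow> real) \<Rightarrow> (complex \<Rightarrow> complex) set" where
  "D1 \<omega> = {f. f holomorphic_on ball 0 1 \<and> D1_norm \<omega> f < \<infinity>}"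

definition Tg :: "(complex \<Rightarrow> complex) \<Rightarrow> (complex \<Rightarrow> complex) \<Rightarrow> complex \<Rightarrow> complex" where
  "Tg g f z = contour_integral (linepath 0 z) (\<lambda>\<zeta>. f \<zeta> * deriv g \<zeta>)"

definition T_Hinf :: "(real \<Rightarrow> real) \<Rightarrow> (complex \<Rightarrow> complex) set" where
  "T_Hinf \<omega> = {g. g holomorphic_on ball 0 1 \<and>
     (\<exists>C::real. \<forall>f\<in>D1 \<omega>. \<forall>z\<in>ball 0 1. ennreal (norm (Tg g f z)) \<le> ennreal C * D1_norm \<omega> f)}"

end

theory Submission
  imports Defs
begin

text \<open>
  Write $W = \widehat\omega$. All four statements are compared through their negations.

  If $1 - r \le C\,W(r)$, then, since the circle means of $|f'|$ increase with the radius, a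
  layer-cake argument only needs the tail estimate $\int_a^1 r\,dr \lesssim \int_a^1 r\,\omega(r)\,dr$
  to give $\|f\|_{D^1_0} \lesssim \|f\|_{D^1_\omega}$. If this embedding is bounded, then $g(z) = z$
  gives a bounded $T_g$: with $F' = f$ and $F(0) = 0$,
  $F(z) - z f(0) = \int_0^1 2\rho (1 - \rho^2) z^2 f'(\rho^2 z)\,d\rho$, and Cauchy's formula on $|w| = \rho$
  bounds $(1 - \rho)|f'(\rho^2 z)|$ by the circle mean of $|f'|$ at radius $\rho$.

  Conversely let $T_g$ be bounded with $g$ not constant, and let $b_m$ be a nonzero Taylor
  coefficient of $g'$. Testing on $f_\alpha(z) = ((1 - |\alpha|)/(1 - \alpha z))^\gamma$, whose norm is
  $\lesssim W(|\alpha|)$ for $\gamma$ large by the doubling condition, and averaging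
  $e^{-i(m+1)t}\, T_g f_{\alpha}(a e^{it})$ with $\alpha = a e^{-it}$ over $t$ isolates $b_m$ and yields
  $1 - a \lesssim W(a)$. The same kernel estimate gives the upper bound for the moments that is
  needed for (iii).
\<close>

text \<open>For a fixed symbol g, the value of T_g f at one point mixes all Taylor coefficients of
  g'. What helps is that the sup bound holds at every point of the disc: the test function can be
  rotated together with the evaluation point, so its values along the radius to that point do not
  depend on the angle t, and averaging over t acts on g' alone. The coefficient b_m then comes
  multiplied by the integral of a positive function, and the last stretch of the radius, of length 1
  - a, already gives that integral the size 1 - a. For (iii), both directions pass through the
  statement that n \<omega>_n is bounded below for n >= 1. The series is bounded termwise by a
  geometric one, and conversely is cut down to a block of n terms of comparable size. Since
  \<omega>_n is controlled by W near 1 - 1/n, this lower bound is the negation of (ii) read along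
  the points 1 - 1/n.\<close>

section \<open>Polar coordinates\<close>

text \<open>The image measure \<open>\<nu>\<close> is translation invariant, so integrating
  \<open>indicator A x * indicator U (y - x)\<close> against \<open>\<nu>\<close> and Lebesgue measure in both orders shows that
  the two are proportional; a ball \<open>U\<close> around the origin fixes the constant.\<close>

lemma orthogonal_transformation_distr_lborel:
  fixes T :: "'a::euclidean_space \<Rightarrow> 'a"
  assumes T: "orthogonal_transformation T"
  shows "distr lborel borel T = lborel"
proof -
  define \<nu> where "\<nu> = distr lborel borel T"
  have lin: "linear T" using T by (simp add: orthogonal_transformation_def)
  have [measurable]: "T \<in> borel_measurable borel"
    using lin by (intro borel_measurable_continuous_onI linear_continuous_on linear_conv_bounded_linear[THEN iffD1])
  have surj: "surj T" using T by (rule orthogonal_transformation_surj)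
  have nT: "norm (T x) = norm x" for x using T by (simp add: orthogonal_transformation)
  have [measurable_cong]: "sets \<nu> = sets borel" by (simp add: \<nu>_def)
  have ball: "emeasure \<nu> (ball 0 R) = emeasure lborel (ball 0 R :: 'a set)" for R
  proof -
    have "T -` ball 0 R = ball 0 R" by (auto simp: nT)
    then show ?thesis by (simp add: \<nu>_def emeasure_distr)
  qed
  have transl: "(\<integral>\<^sup>+x. f (x + y) \<partial>\<nu>) = (\<integral>\<^sup>+x. f x \<partial>\<nu>)" if [measurable]: "f \<in> borel_measurable borel" for f y
  proof -
    obtain y' where y': "y = T y'" using surj by (metis surjD)
    have "(\<integral>\<^sup>+x. f (x + y) \<partial>\<nu>) = (\<integral>\<^sup>+x. f (T (x + y')) \<partial>lborel)"
      by (simp add: \<nu>_def nn_integral_distr y' linear_add[OF lin])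
    also have "\<dots> = (\<integral>\<^sup>+x. f (T x) \<partial>distr lborel borel ((+) y'))"
      by (subst nn_integral_distr) (auto simp: add.commute)
    finally show ?thesis by (simp add: lborel_distr_plus \<nu>_def nn_integral_distr)
  qed
  interpret N: sigma_finite_measure \<nu>
  proof (intro sigma_finite_measure.intro exI[of _ "range (\<lambda>n::nat. ball 0 (real n))"] conjI ballI)
    show "\<Union> (range (\<lambda>n::nat. ball 0 (real n))) = space \<nu>"
      by (auto simp: \<nu>_def intro: reals_Archimedean2)
  next
    fix a assume "a \<in> range (\<lambda>n::nat. ball (0::'a) (real n))"
    then obtain n :: nat where a: "a = ball 0 (real n)" by auto
    show "emeasure \<nu> a \<noteq> \<infinity>"
      using emeasure_lborel_ball_finite[of "0::'a" "real n"] unfolding a ball by simp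
  qed auto
  interpret P: pair_sigma_finite \<nu> lborel ..
  let ?U = "ball 0 1 :: 'a set"
  define u :: "'a \<Rightarrow> ennreal" where "u = indicator ?U"
  have [measurable]: "u \<in> borel_measurable borel" unfolding u_def by (rule borel_measurable_indicator) auto
  have u_int: "(\<integral>\<^sup>+x. u x \<partial>lborel) = emeasure lborel ?U" "(\<integral>\<^sup>+x. u x \<partial>\<nu>) = emeasure lborel ?U"
    by (simp_all add: u_def ball)
  have u_minus: "u (- x) = u x" for x by (simp add: u_def indicator_def)
  have eq: "emeasure \<nu> A = emeasure lborel A" if A[measurable]: "A \<in> sets borel" for A
  proof -
    have U: "emeasure lborel ?U \<noteq> 0" "emeasure lborel ?U \<noteq> top"
      using emeasure_lborel_ball_finite[of "0::'a" 1] content_ball_pos[of 1 "0::'a"]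
      by (auto simp: measure_def)
    have "emeasure lborel ?U * emeasure \<nu> A = (\<integral>\<^sup>+x. indicator A x * emeasure lborel ?U \<partial>\<nu>)"
      by (simp add: nn_integral_multc mult.commute)
    also have "\<dots> = (\<integral>\<^sup>+x. (\<integral>\<^sup>+y. indicator A x * u (y - x) \<partial>lborel) \<partial>\<nu>)"
    proof (intro nn_integral_cong)
      fix x :: 'a
      have "(\<integral>\<^sup>+y. u (y - x) \<partial>lborel) = (\<integral>\<^sup>+y. u y \<partial>distr lborel borel ((+) (-x)))"
        by (subst nn_integral_distr) auto
      then show "indicator A x * emeasure lborel ?U = (\<integral>\<^sup>+y. indicator A x * u (y - x) \<partial>lborel)"
        by (simp add: nn_integral_cmult lborel_distr_plus u_int)
    qed
    also have "\<dots> = (\<integral>\<^sup>+y. (\<integral>\<^sup>+x. indicator A x * u (y - x) \<partial>\<nu>) \<partial>lborel)"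
      by (subst P.Fubini') auto
    also have "\<dots> = (\<integral>\<^sup>+y. (\<integral>\<^sup>+x. indicator A (x + y) * u (-x) \<partial>\<nu>) \<partial>lborel)"
    proof (rule nn_integral_cong)
      fix y
      show "(\<integral>\<^sup>+x. indicator A x * u (y - x) \<partial>\<nu>) = (\<integral>\<^sup>+x. indicator A (x + y) * u (- x) \<partial>\<nu>)"
        using transl[of "\<lambda>x. indicator A x * u (y - x)" y] by simp
    qed
    also have "\<dots> = (\<integral>\<^sup>+x. (\<integral>\<^sup>+y. indicator A (x + y) * u (-x) \<partial>lborel) \<partial>\<nu>)"
      by (subst P.Fubini') auto
    also have "\<dots> = (\<integral>\<^sup>+x. emeasure lborel A * u x \<partial>\<nu>)"
    proof (intro nn_integral_cong)
      fix x :: 'a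
      have "(\<integral>\<^sup>+y. indicator A (x + y) \<partial>lborel) = (\<integral>\<^sup>+y. indicator A y \<partial>distr lborel borel ((+) x))"
        by (subst nn_integral_distr) auto
      then show "(\<integral>\<^sup>+y. indicator A (x + y) * u (-x) \<partial>lborel) = emeasure lborel A * u x"
        by (simp add: nn_integral_multc lborel_distr_plus u_minus)
    qed
    also have "\<dots> = emeasure lborel ?U * emeasure lborel A"
      by (simp add: nn_integral_cmult u_int) (rule mult.commute)
    finally show ?thesis using U by (simp add: ennreal_mult_cancel_left)
  qed
  show ?thesis
    by (rule measure_eqI) (use eq in \<open>auto simp: \<nu>_def\<close>)
qed

lemma nn_integral_lborel_rotate:
  assumes [measurable]: "g \<in> borel_measurable borel" and c: "cmod c = 1"
  shows "(\<integral>\<^sup>+z. g (c * z) \<partial>lborel) = (\<integral>\<^sup>+z. g z \<partial>lborel)"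
proof -
  have "orthogonal_transformation ((*) c)"
    using c by (simp add: orthogonal_transformation norm_mult)
  from orthogonal_transformation_distr_lborel[OF this]
  have "(\<integral>\<^sup>+z. g z \<partial>lborel) = (\<integral>\<^sup>+z. g z \<partial>distr lborel borel ((*) c))" by simp
  also have "\<dots> = (\<integral>\<^sup>+z. g (c * z) \<partial>lborel)" by (subst nn_integral_distr) auto
  finally show ?thesis ..
qed

text \<open>The shifted window is cut at \<open>2*pi\<close>, and the part beyond is moved back by
  one period. Half-open intervals make the pieces disjoint; \<open>AE\<close> discards the endpoint,
  a null set.\<close>

lemma nn_integral_periodic_shift:
  fixes p :: "real \<Rightarrow> ennreal"
  assumes [measurable]: "p \<in> borel_measurable borel"
    and per: "\<And>x. p (x + 2*pi) = p x" and \<alpha>: "0 \<le> \<alpha>" "\<alpha> \<le> 2*pi"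
  shows "(\<integral>\<^sup>+x\<in>{0..2*pi}. p (x + \<alpha>) \<partial>lborel) = (\<integral>\<^sup>+x\<in>{0..2*pi}. p x \<partial>lborel)"
proof -
  have AE: "(\<integral>\<^sup>+x\<in>{0..2*pi}. q x \<partial>lborel) = (\<integral>\<^sup>+x\<in>{0..<2*pi}. q x \<partial>lborel)" for q :: "real \<Rightarrow> ennreal"
    by (intro nn_integral_cong_AE eventually_mono[OF AE_lborel_singleton[of "2*pi"]])
       (simp add: indicator_def less_le)
  have "(\<integral>\<^sup>+x\<in>{0..<2*pi}. p (x + \<alpha>) \<partial>lborel) = (\<integral>\<^sup>+x. p (\<alpha> + 1 * x) * indicator {\<alpha>..<2*pi+\<alpha>} (\<alpha> + 1 * x) \<partial>lborel)"
    by (intro nn_integral_cong) (auto simp: indicator_def add.commute)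
  also have "\<dots> = (\<integral>\<^sup>+x\<in>{\<alpha>..<2*pi+\<alpha>}. p x \<partial>lborel)"
    by (subst nn_integral_real_affine[where c=1 and t=\<alpha> and f="\<lambda>x. p x * indicator {\<alpha>..<2*pi+\<alpha>} x"]) auto
  also have "\<dots> = (\<integral>\<^sup>+x. p x * indicator {\<alpha>..<2*pi} x + p x * indicator {2*pi..<2*pi+\<alpha>} x \<partial>lborel)"
    using \<alpha> by (intro nn_integral_cong) (auto simp: indicator_def)
  also have "\<dots> = (\<integral>\<^sup>+x\<in>{\<alpha>..<2*pi}. p x \<partial>lborel) + (\<integral>\<^sup>+x\<in>{2*pi..<2*pi+\<alpha>}. p x \<partial>lborel)"
    by (rule nn_integral_add) auto
  also have "(\<integral>\<^sup>+x\<in>{2*pi..<2*pi+\<alpha>}. p x \<partial>lborel) = (\<integral>\<^sup>+x. p (2*pi + 1*x) * indicator {2*pi..<2*pi+\<alpha>} (2*pi + 1*x) \<partial>lborel)"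
    by (subst nn_integral_real_affine[where c=1 and t="2*pi" and f="\<lambda>x. p x * indicator {2*pi..<2*pi+\<alpha>} x"]) auto
  also have "\<dots> = (\<integral>\<^sup>+x\<in>{0..<\<alpha>}. p x \<partial>lborel)"
    using per by (intro nn_integral_cong) (auto simp: indicator_def add.commute)
  also have "(\<integral>\<^sup>+x\<in>{\<alpha>..<2*pi}. p x \<partial>lborel) + (\<integral>\<^sup>+x\<in>{0..<\<alpha>}. p x \<partial>lborel)
      = (\<integral>\<^sup>+x. p x * indicator {\<alpha>..<2*pi} x + p x * indicator {0..<\<alpha>} x \<partial>lborel)"
    by (rule nn_integral_add[symmetric]) auto
  also have "\<dots> = (\<integral>\<^sup>+x\<in>{0..<2*pi}. p x \<partial>lborel)"
    using \<alpha> by (intro nn_integral_cong) (auto simp: indicator_def)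
  finally show ?thesis by (simp add: AE)
qed

lemma cis_measurable [measurable]: "cis \<in> borel_measurable borel"
  by (intro borel_measurable_continuous_onI continuous_intros)

lemma nn_integral_circle_rotate:
  assumes [measurable]: "g \<in> borel_measurable borel"
  shows "(\<integral>\<^sup>+\<theta>\<in>{0..2*pi}. g (cis \<theta> * z) \<partial>lborel) = (\<integral>\<^sup>+\<theta>\<in>{0..2*pi}. g (cmod z * cis \<theta>) \<partial>lborel)"
proof -
  have z: "z = cmod z * cis (Arg2pi z)"
    using Arg2pi_eq[of z] by (simp add: cis_conv_exp mult.commute)
  have "(\<integral>\<^sup>+\<theta>\<in>{0..2*pi}. g (cis \<theta> * z) \<partial>lborel) = (\<integral>\<^sup>+\<theta>\<in>{0..2*pi}. g (cmod z * cis (\<theta> + Arg2pi z)) \<partial>lborel)"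
    by (subst z) (simp add: cis_mult[symmetric] mult_ac)
  also have "\<dots> = (\<integral>\<^sup>+\<theta>\<in>{0..2*pi}. g (cmod z * cis \<theta>) \<partial>lborel)"
    using Arg2pi_ge_0[of z] Arg2pi_lt_2pi[of z]
    by (intro nn_integral_periodic_shift) (auto simp: cis_mult[symmetric])
  finally show ?thesis .
qed

text \<open>Both measures give a half-line \<open>{..a}\<close> with \<open>a \<ge> 0\<close> the
  area \<open>pi * a^2\<close> of a disc, whose derivative in the radius is the density. The
  half-lines with rational end are a countable cover by sets of finite measure, which is what
  uniqueness on a generator requires.\<close>

lemma distr_cmod_lborel:
  "distr lborel borel cmod = density lborel (\<lambda>r. ennreal (2 * pi * r * indicator {0..} r))"
proof (rule measure_eqI_generator_eq_countable)
  let ?E = "range (\<lambda>a::real. {..a})"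
  show "Int_stable ?E" by (auto simp: Int_stable_def)
  show "?E \<subseteq> Pow UNIV" by auto
  show "sets (distr lborel borel cmod) = sigma_sets UNIV ?E"
    "sets (density lborel (\<lambda>r. ennreal (2 * pi * r * indicator {0..} r))) = sigma_sets UNIV ?E"
    by (simp_all add: borel_eq_atMost)
  show "(\<lambda>a::real. {..a}) ` \<rat> \<subseteq> ?E" "countable ((\<lambda>a::real. {..a}) ` \<rat>)" by (auto intro: countable_rat)
  show "\<Union> ((\<lambda>a::real. {..a}) ` \<rat>) = UNIV"
    using Rats_no_top_le by (auto simp: Bex_def)
  have M: "emeasure (distr lborel borel cmod) {..a} = (if a < 0 then 0 else ennreal (pi * a^2))" for a
  proof -
    have "cmod -` {..a} = cball 0 a" by auto
    moreover have "unit_ball_vol 2 = pi" by (simp add: unit_ball_vol_2)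
    ultimately show ?thesis by (auto simp: emeasure_distr emeasure_cball)
  qed
  show "emeasure (distr lborel borel cmod) a \<noteq> \<infinity>" if "a \<in> (\<lambda>a::real. {..a}) ` \<rat>" for a
    using that by (auto simp: M split: if_splits)
  fix X assume "X \<in> ?E"
  then obtain a where X: "X = {..a}" by auto
  show "emeasure (distr lborel borel cmod) X = emeasure (density lborel (\<lambda>r. ennreal (2 * pi * r * indicator {0..} r))) X"
  proof (cases "a < 0")
    case True
    then have "(\<lambda>r. ennreal (2 * pi * r * indicator {0..} r) * indicator {..a} r) = (\<lambda>_. 0)"
      by (auto simp: indicator_def fun_eq_iff)
    with True show ?thesis unfolding X M by (simp add: emeasure_density)
  next
    case False
    have "emeasure (density lborel (\<lambda>r. ennreal (2 * pi * r * indicator {0..} r))) {..a} = (\<integral>\<^sup>+r. ennreal (2*pi*r) * indicator {0..a} r \<partial>lborel)"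
      by (simp add: emeasure_density) (intro nn_integral_cong, auto simp: indicator_def)
    also have "\<dots> = ennreal (pi * a^2 - pi * 0^2)"
      using False by (intro nn_integral_FTC_Icc) (auto intro!: derivative_eq_intros)
    finally show ?thesis unfolding X M using False by simp
  qed
qed

text \<open>Averaging over all rotations replaces \<open>g z\<close> by a function of
  \<open>cmod z\<close> only, and the integral of such a function is read off from the image measure
  under \<open>cmod\<close>. No Jacobian of the polar map enters; the factor \<open>2*pi\<close>
  from the averaging cancels the one in the density.\<close>

lemma nn_integral_polar:
  assumes [measurable]: "g \<in> borel_measurable borel"
  shows "(\<integral>\<^sup>+z. g z \<partial>lborel) =
    (\<integral>\<^sup>+r. (\<integral>\<^sup>+\<theta>\<in>{0..2*pi}. g (of_real r * cis \<theta>) \<partial>lborel) * ennreal (r * indicator {0..} r) \<partial>lborel)"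
proof -
  define G where "G r = (\<integral>\<^sup>+\<theta>\<in>{0..2*pi}. g (of_real r * cis \<theta>) \<partial>lborel)" for r :: real
  have [measurable]: "G \<in> borel_measurable borel" unfolding G_def by measurable
  have "ennreal (2*pi) * (\<integral>\<^sup>+z. g z \<partial>lborel) = (\<integral>\<^sup>+\<theta>. (\<integral>\<^sup>+z. g z \<partial>lborel) * indicator {0..2*pi} (\<theta>::real) \<partial>lborel)"
    by (simp add: nn_integral_cmult mult.commute)
  also have "\<dots> = (\<integral>\<^sup>+\<theta>. (\<integral>\<^sup>+z. g (cis \<theta> * z) * indicator {0..2*pi} \<theta> \<partial>lborel) \<partial>lborel)"
    by (intro nn_integral_cong) (simp add: nn_integral_multc nn_integral_lborel_rotate)
  also have "\<dots> = (\<integral>\<^sup>+z. (\<integral>\<^sup>+\<theta>. g (cis \<theta> * z) * indicator {0..2*pi} \<theta> \<partial>lborel) \<partial>lborel)"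
    by (rule lborel_pair.Fubini') measurable
  also have "\<dots> = (\<integral>\<^sup>+z. G (cmod z) \<partial>lborel)"
    by (simp add: nn_integral_circle_rotate G_def)
  also have "\<dots> = (\<integral>\<^sup>+r. G r \<partial>distr lborel borel cmod)"
    by (simp add: nn_integral_distr)
  also have "\<dots> = (\<integral>\<^sup>+r. ennreal (2 * pi * r * indicator {0..} r) * G r \<partial>lborel)"
    by (simp add: distr_cmod_lborel nn_integral_density)
  also have "\<dots> = (\<integral>\<^sup>+r. ennreal (2*pi) * (G r * ennreal (r * indicator {0..} r)) \<partial>lborel)"
    by (intro nn_integral_cong) (auto simp: ennreal_mult[symmetric] ennreal_mult'' mult_ac indicator_def)
  also have "\<dots> = ennreal (2*pi) * (\<integral>\<^sup>+r. G r * ennreal (r * indicator {0..} r) \<partial>lborel)"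
    by (simp add: nn_integral_cmult)
  finally show ?thesis by (simp add: ennreal_mult_cancel_left G_def)
qed

section \<open>Circle means of holomorphic functions\<close>

text \<open>This is \<open>2*pi\<close> times the usual integral mean; the factor
  \<open>1 / pi\<close> of the area measure is carried separately in
  \<open>D1_norm_polar\<close>.\<close>

definition circle_integral :: "(complex \<Rightarrow> complex) \<Rightarrow> real \<Rightarrow> real" where
  "circle_integral h r = integral {0..2*pi} (\<lambda>\<theta>. norm (h (of_real r * cis \<theta>)))"

lemma continuous_on_circle:
  fixes h :: "complex \<Rightarrow> complex"
  assumes "continuous_on (ball 0 1) h" "cmod z < 1"
  shows "continuous_on S (\<lambda>\<theta>. h (z * cis \<theta>))"
  by (rule continuous_on_compose2[OF assms(1)]) (use assms(2) in \<open>auto intro!: continuous_intros simp: norm_mult\<close>)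

text \<open>Integrability is not assumed because \<open>integral\<close> takes the value 0 on
  functions that are not integrable.\<close>

lemma integral_norm_nonneg: "0 \<le> integral S (\<lambda>x. norm (f x))"
  by (cases "(\<lambda>x. norm (f x)) integrable_on S")
     (auto intro: Henstock_Kurzweil_Integration.integral_nonneg simp: not_integrable_integral)

lemma circle_integral_nonneg: "0 \<le> circle_integral h r"
  unfolding circle_integral_def by (rule integral_norm_nonneg)

lemma circle_has_integral:
  assumes "continuous_on (ball 0 1) h" "0 \<le> r" "r < 1"
  shows "((\<lambda>\<theta>. norm (h (of_real r * cis \<theta>))) has_integral circle_integral h r) {0..2*pi}"
  unfolding circle_integral_def
  by (intro integrable_integral integrable_continuous_real continuous_intros continuous_on_circle)
     (use assms in auto)

lemma circle_nn_integral:
  assumes h: "continuous_on (ball 0 1) h" and z: "cmod z < 1"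
  shows "(\<integral>\<^sup>+\<theta>\<in>{0..2*pi}. ennreal (norm (h (z * cis \<theta>))) \<partial>lborel) = ennreal (circle_integral h (cmod z))"
proof -
  \<comment> \<open>Nothing is known about \<open>h\<close> outside the disc, so it is cut off there
    to obtain a Borel function on the whole plane.\<close>
  define g where "g w = ennreal (indicator (ball 0 1) w *\<^sub>R norm (h w))" for w
  have [measurable]: "g \<in> borel_measurable borel"
    unfolding g_def by (intro borel_measurable_continuous_on_indicator measurable_compose[OF _ measurable_ennreal] continuous_intros h) auto
  have "(\<integral>\<^sup>+\<theta>\<in>{0..2*pi}. ennreal (norm (h (z * cis \<theta>))) \<partial>lborel) = (\<integral>\<^sup>+\<theta>\<in>{0..2*pi}. g (cis \<theta> * z) \<partial>lborel)"
    using z by (intro nn_integral_cong) (simp add: g_def norm_mult mult.commute)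
  also have "\<dots> = (\<integral>\<^sup>+\<theta>\<in>{0..2*pi}. g (cmod z * cis \<theta>) \<partial>lborel)"
    by (rule nn_integral_circle_rotate) measurable
  also have "\<dots> = (\<integral>\<^sup>+\<theta>\<in>{0..2*pi}. ennreal (norm (h (cmod z * cis \<theta>))) \<partial>lborel)"
    using z by (intro nn_integral_cong) (simp add: g_def norm_mult)
  also have "\<dots> = ennreal (circle_integral h (cmod z))"
    using circle_has_integral[OF h, of "cmod z"] z by (intro nn_integral_has_integral_lebesgue') auto
  finally show ?thesis .
qed

lemma circle_integral_rotate:
  assumes h: "continuous_on (ball 0 1) h" and z: "cmod z < 1"
  shows "integral {0..2*pi} (\<lambda>\<theta>. norm (h (z * cis \<theta>))) = circle_integral h (cmod z)"
proof -
  have "((\<lambda>\<theta>. norm (h (z * cis \<theta>))) has_integral integral {0..2*pi} (\<lambda>\<theta>. norm (h (z * cis \<theta>)))) {0..2*pi}"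
    by (intro integrable_integral integrable_continuous_real continuous_intros continuous_on_circle h z)
  then have "ennreal (integral {0..2*pi} (\<lambda>\<theta>. norm (h (z * cis \<theta>)))) = ennreal (circle_integral h (cmod z))"
    by (subst circle_nn_integral[OF h z, symmetric], intro nn_integral_has_integral_lebesgue'[symmetric]) auto
  then show ?thesis
    by (subst (asm) ennreal_inj) (auto simp: circle_integral_nonneg integral_norm_nonneg)
qed

lemma continuous_on_circle_integral:
  assumes h: "continuous_on (ball 0 1) h"
  shows "continuous_on {0..<1} (circle_integral h)"
proof -
  have "continuous_on ({0..<1} \<times> cbox 0 (2*pi)) (\<lambda>(r, \<theta>). norm (h (of_real r * cis \<theta>)))"
    unfolding case_prod_unfold
    by (intro continuous_intros continuous_on_compose2[OF h]) (auto simp: norm_mult)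
  from integral_continuous_on_param[OF this] show ?thesis
    by (simp add: circle_integral_def[abs_def])
qed

text \<open>The maximum principle is applied to the integral of \<open>h (z * cis \<theta>) * \<phi> \<theta>\<close> over \<open>\<theta>\<close>, where \<open>\<phi>\<close>
  is a continuous approximation of the conjugate sign of \<open>h (r * cis \<theta>)\<close>.\<close>

lemma circle_integral_mono:
  assumes h: "h holomorphic_on ball 0 1" and rs: "0 \<le> r" "r \<le> s" "s < 1"
  shows "circle_integral h r \<le> circle_integral h s"
proof (cases "s = 0")
  case True
  then show ?thesis using rs by simp
next
  case False
  then have s0: "s > 0" using rs by simp
  have hc: "continuous_on (ball 0 1) h" using h by (rule holomorphic_on_imp_continuous_on)
  have hd: "continuous_on (ball 0 1) (deriv h)"
    using h by (intro holomorphic_on_imp_continuous_on holomorphic_deriv) auto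
  have "circle_integral h r \<le> circle_integral h s + e" if e: "e > 0" for e
  proof -
    define \<epsilon> where "\<epsilon> = e / (2*pi)"
    have \<epsilon>: "\<epsilon> > 0" using e by (simp add: \<epsilon>_def)
    \<comment> \<open>Adding \<open>\<epsilon>\<close> to the denominator keeps
      \<open>\<phi>\<close> continuous at zeros of \<open>h\<close>. It costs at most
      \<open>\<epsilon>\<close> at each angle, hence \<open>2*pi*\<epsilon> = e\<close> after
      integration.\<close>
    define \<phi> where "\<phi> \<theta> = cnj (h (of_real r * cis \<theta>)) / of_real (norm (h (of_real r * cis \<theta>)) + \<epsilon>)" for \<theta>
    have pos: "norm (h w) + \<epsilon> \<noteq> 0" for w using \<epsilon> norm_ge_zero[of "h w"] by linarith
    have \<phi>c: "continuous_on S \<phi>" for S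
      unfolding \<phi>_def using rs pos
      by (intro continuous_intros continuous_on_circle hc) (auto simp del: of_real_add)
    have \<phi>n: "norm (\<phi> \<theta>) \<le> 1" for \<theta>
      using \<epsilon> norm_ge_zero[of "h (of_real r * cis \<theta>)"]
      by (simp add: \<phi>_def norm_divide divide_le_eq_1 add_nonneg_pos del: of_real_add norm_ge_zero)
    define G where "G z = integral (cbox 0 (2*pi)) (\<lambda>\<theta>. h (z * cis \<theta>) * \<phi> \<theta>)" for z
    have "G holomorphic_on ball 0 1"
      unfolding G_def
    proof (rule leibniz_rule_holomorphic[where fx="\<lambda>z \<theta>. deriv h (z * cis \<theta>) * cis \<theta> * \<phi> \<theta>"])
      fix z \<theta> assume "z \<in> ball (0::complex) 1"
      then have "z * cis \<theta> \<in> ball 0 1" by (simp add: norm_mult)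
      then have "(h has_field_derivative deriv h (z * cis \<theta>)) (at (z * cis \<theta>))"
        using h by (intro holomorphic_derivI[of _ "ball 0 1"]) auto
      moreover have "((\<lambda>z. z * cis \<theta>) has_field_derivative cis \<theta>) (at z within ball 0 1)"
        by (auto intro!: derivative_eq_intros)
      ultimately have "((\<lambda>z. h (z * cis \<theta>)) has_field_derivative deriv h (z * cis \<theta>) * cis \<theta>) (at z within ball 0 1)"
        by (rule DERIV_chain2)
      then show "((\<lambda>z. h (z * cis \<theta>) * \<phi> \<theta>) has_field_derivative deriv h (z * cis \<theta>) * cis \<theta> * \<phi> \<theta>) (at z within ball 0 1)"
        by (rule DERIV_cmult_right)
    next
      fix z assume "z \<in> ball (0::complex) 1"
      then show "(\<lambda>\<theta>. h (z * cis \<theta>) * \<phi> \<theta>) integrable_on cbox 0 (2 * pi)"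
        by (intro integrable_continuous continuous_intros continuous_on_circle hc \<phi>c) auto
    next
      show "continuous_on (ball 0 1 \<times> cbox 0 (2 * pi)) (\<lambda>(z, \<theta>). deriv h (z * cis \<theta>) * cis \<theta> * \<phi> \<theta>)"
        unfolding case_prod_unfold
        by (intro continuous_intros continuous_on_compose2[OF hd] continuous_on_compose2[OF \<phi>c[of UNIV]]) (auto simp: norm_mult)
    qed auto
    then have holG: "G holomorphic_on ball 0 1" .
    have "norm (G (of_real r)) \<le> circle_integral h s"
    proof (rule maximum_modulus_frontier[where S="cball 0 s" and f=G and \<xi>="of_real r"])
      show "G holomorphic_on interior (cball 0 s)"
        using rs by (intro holomorphic_on_subset[OF holG]) auto
      show "continuous_on (closure (cball 0 s)) G"
        using rs by (intro holomorphic_on_imp_continuous_on holomorphic_on_subset[OF holG]) auto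
      fix z :: complex assume "z \<in> frontier (cball 0 s)"
      then have z: "cmod z = s" using s0 by (simp add: frontier_cball)
      have "norm (G z) \<le> integral (cbox 0 (2*pi)) (\<lambda>\<theta>. norm (h (z * cis \<theta>)))"
        unfolding G_def
      proof (rule integral_norm_bound_integral)
        show "(\<lambda>\<theta>. h (z * cis \<theta>) * \<phi> \<theta>) integrable_on cbox 0 (2 * pi)"
          "(\<lambda>\<theta>. norm (h (z * cis \<theta>))) integrable_on cbox 0 (2 * pi)"
          using z rs by (auto intro!: integrable_continuous_real continuous_intros continuous_on_circle hc \<phi>c)
        show "norm (h (z * cis \<theta>) * \<phi> \<theta>) \<le> norm (h (z * cis \<theta>))" for \<theta>
          using \<phi>n[of \<theta>] by (simp add: norm_mult mult_left_le)
      qed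
      also have "\<dots> = circle_integral h s"
        using circle_integral_rotate[OF hc, of z] z rs by simp
      finally show "norm (G z) \<le> circle_integral h s" .
    qed (use rs in auto)
    moreover have "circle_integral h r - 2*pi*\<epsilon> \<le> Re (G (of_real r))"
    proof (rule has_integral_le)
      have "((\<lambda>\<theta>. norm (h (of_real r * cis \<theta>)) - \<epsilon>) has_integral circle_integral h r - integral {0..2*pi} (\<lambda>_. \<epsilon>)) {0..2*pi}"
        using rs by (intro has_integral_diff circle_has_integral hc integrable_integral) auto
      then show "((\<lambda>\<theta>. norm (h (of_real r * cis \<theta>)) - \<epsilon>) has_integral circle_integral h r - 2*pi*\<epsilon>) {0..2*pi}"
        by simp
      have "((\<lambda>\<theta>. h (of_real r * cis \<theta>) * \<phi> \<theta>) has_integral G (of_real r)) {0..2*pi}"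
        unfolding G_def cbox_interval using rs
        by (intro integrable_integral integrable_continuous_real continuous_intros continuous_on_circle hc \<phi>c) auto
      then show "((\<lambda>\<theta>. Re (h (of_real r * cis \<theta>) * \<phi> \<theta>)) has_integral Re (G (of_real r))) {0..2*pi}"
        by (rule has_integral_linear[OF _ bounded_linear_Re, unfolded o_def])
      fix \<theta>
      let ?w = "h (of_real r * cis \<theta>)"
      have "Re (?w * \<phi> \<theta>) = (norm ?w)\<^sup>2 / (norm ?w + \<epsilon>)"
      proof -
        have "?w * \<phi> \<theta> = of_real ((norm ?w)\<^sup>2 / (norm ?w + \<epsilon>))"
          using complex_norm_square[of ?w] by (simp add: \<phi>_def)
        then show ?thesis by simp
      qed
      \<comment> \<open>The product of \<open>norm ?w - \<epsilon>\<close> and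
        \<open>norm ?w + \<epsilon>\<close> is the square of \<open>norm ?w\<close> minus that of
        \<open>\<epsilon>\<close>.\<close>
      moreover have "norm ?w - \<epsilon> \<le> (norm ?w)\<^sup>2 / (norm ?w + \<epsilon>)"
        by (subst pos_le_divide_eq) (use \<epsilon> in \<open>auto simp: power2_eq_square algebra_simps add_pos_nonneg\<close>)
      ultimately show "norm ?w - \<epsilon> \<le> Re (?w * \<phi> \<theta>)" by simp
    qed
    ultimately show ?thesis
      using complex_Re_le_cmod[of "G (of_real r)"] by (simp add: \<epsilon>_def)
  qed
  then show ?thesis by (rule field_le_epsilon)
qed

text \<open>The point has modulus at most \<rho>^2, so its distance from the circle of radius \<rho>
  is at least \<rho> (1 - \<rho>). The factor \<rho> cancels against the speed of the circle, and
  the Cauchy kernel costs exactly 1 / (1 - \<rho>), with no loss for small \<rho>.\<close>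

lemma norm_le_circle_integral:
  assumes h: "h holomorphic_on ball 0 1" and \<rho>: "0 < \<rho>" "\<rho> < 1" and z: "cmod z \<le> 1"
  shows "2 * pi * (1 - \<rho>) * norm (h (of_real (\<rho>\<^sup>2) * z)) \<le> circle_integral h \<rho>"
proof -
  define w where "w = of_real (\<rho>\<^sup>2) * z"
  have hc: "continuous_on (ball 0 1) h" using h by (rule holomorphic_on_imp_continuous_on)
  have w: "cmod w \<le> \<rho>\<^sup>2" using z by (simp add: w_def norm_mult norm_power mult_left_le)
  have w\<rho>: "cmod w < \<rho>" using \<rho> by (intro le_less_trans[OF w]) (simp add: power2_eq_square)
  have "((\<lambda>u. h u / (u - w)) has_contour_integral (2 * of_real pi * \<i> * h w)) (circlepath 0 \<rho>)"
    using \<rho> w\<rho> by (intro Cauchy_integral_circlepath continuous_on_subset[OF hc] holomorphic_on_subset[OF h]) auto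
  then have I: "((\<lambda>\<theta>. h (0 + of_real \<rho> * cis \<theta>) / (0 + of_real \<rho> * cis \<theta> - w) * of_real \<rho> * \<i> * cis \<theta>) has_integral (2 * of_real pi * \<i> * h w)) {0..2*pi}"
    unfolding circlepath_def by (subst (asm) has_contour_integral_part_circlepath_iff) auto
  have "norm (2 * of_real pi * \<i> * h w) \<le> (circle_integral h \<rho> * (1 / (1 - \<rho>))) \<bullet> 1"
  proof (rule has_integral_norm_bound_integral_component [OF I])
    show "((\<lambda>\<theta>. norm (h (of_real \<rho> * cis \<theta>)) * (1 / (1 - \<rho>))) has_integral circle_integral h \<rho> * (1 / (1 - \<rho>))) {0..2*pi}"
      using \<rho> by (intro has_integral_mult_left circle_has_integral hc) auto
    fix \<theta>
    have "\<rho> * (1 - \<rho>) \<le> cmod (of_real \<rho> * cis \<theta>) - cmod w"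
      using \<rho> w by (simp add: norm_mult power2_eq_square algebra_simps)
    also have "\<dots> \<le> cmod (of_real \<rho> * cis \<theta> - w)" by (rule norm_triangle_ineq2)
    finally have "\<rho> * (1 - \<rho>) \<le> cmod (of_real \<rho> * cis \<theta> - w)" .
    then have "\<rho> / cmod (of_real \<rho> * cis \<theta> - w) \<le> 1 / (1 - \<rho>)"
      using \<rho> frac_le[of \<rho> \<rho> "\<rho> * (1 - \<rho>)"] by simp
    from mult_left_mono[OF this norm_ge_zero[of "h (of_real \<rho> * cis \<theta>)"]]
    show "norm (h (0 + of_real \<rho> * cis \<theta>) / (0 + of_real \<rho> * cis \<theta> - w) * of_real \<rho> * \<i> * cis \<theta>) \<le> (norm (h (of_real \<rho> * cis \<theta>)) * (1 / (1 - \<rho>))) \<bullet> 1"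
      using \<rho> by (simp add: norm_mult norm_divide)
  qed
  then show ?thesis
    using \<rho> by (simp add: norm_mult w_def field_simps)
qed

text \<open>For u on the unit circle, u - cnj \<beta> equals u times the conjugate of 1 - \<beta> u.
  The integrand is therefore u / ((1 - \<beta> u) (u - cnj \<beta>)), and Cauchy's formula for 1 /
  (1 - \<beta> u) at cnj \<beta> evaluates it. Since du = i u d\<theta>, the contour integral is i
  times the real one, which is why imaginary parts are taken.\<close>

lemma poisson_has_integral:
  assumes \<beta>: "cmod \<beta> < 1"
  shows "((\<lambda>\<theta>. 1 / (norm (1 - \<beta> * cis \<theta>))\<^sup>2) has_integral 2 * pi / (1 - (cmod \<beta>)\<^sup>2)) {0..2*pi}"
proof -
  define f where "f u = 1 / (1 - \<beta> * u)" for u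
  have nz: "1 - \<beta> * u \<noteq> 0" if "cmod u \<le> 1" for u
  proof -
    have "cmod (\<beta> * u) < 1"
      using \<beta> that mult_left_le[of "cmod u" "cmod \<beta>"] by (simp add: norm_mult)
    then show ?thesis by (metis norm_one right_minus_eq less_irrefl)
  qed
  have "((\<lambda>u. f u / (u - cnj \<beta>)) has_contour_integral (2 * of_real pi * \<i> * f (cnj \<beta>))) (circlepath 0 1)"
    using \<beta> nz by (intro Cauchy_integral_circlepath) (auto simp: f_def intro!: continuous_intros holomorphic_intros)
  then have "((\<lambda>\<theta>. f (0 + of_real 1 * cis \<theta>) / (0 + of_real 1 * cis \<theta> - cnj \<beta>) * of_real 1 * \<i> * cis \<theta>) has_integral (2 * of_real pi * \<i> * f (cnj \<beta>))) {0..2*pi}"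
    unfolding circlepath_def by (subst (asm) has_contour_integral_part_circlepath_iff) auto
  then have "((\<lambda>\<theta>. Im (f (0 + of_real 1 * cis \<theta>) / (0 + of_real 1 * cis \<theta> - cnj \<beta>) * of_real 1 * \<i> * cis \<theta>)) has_integral Im (2 * of_real pi * \<i> * f (cnj \<beta>))) {0..2*pi}"
    by (rule has_integral_linear[OF _ bounded_linear_Im, unfolded o_def])
  moreover have "f (cnj \<beta>) = of_real (1 / (1 - (cmod \<beta>)\<^sup>2))"
    using complex_norm_square[of \<beta>] by (simp add: f_def mult.commute)
  moreover have "f (0 + of_real 1 * cis \<theta>) / (0 + of_real 1 * cis \<theta> - cnj \<beta>) * of_real 1 * \<i> * cis \<theta> = \<i> * of_real (1 / (norm (1 - \<beta> * cis \<theta>))\<^sup>2)" for \<theta>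
  proof -
    have "cis \<theta> - cnj \<beta> = cis \<theta> * cnj (1 - \<beta> * cis \<theta>)"
      by (simp add: algebra_simps cis_cnj cis_mult)
    then show ?thesis
      using complex_norm_square[of "1 - \<beta> * cis \<theta>"] by (simp add: f_def)
  qed
  ultimately show ?thesis by simp
qed

section \<open>The norm in polar coordinates and the embedding\<close>

text \<open>The weight enters only through measurability and sign on \<open>{0..<1}\<close>, so that
  the formula serves both \<open>\<omega>\<close> and the constant weight 1. The values of
  \<open>\<omega>\<close> elsewhere are arbitrary, hence the cut-off \<open>v\<close>.\<close>

lemma D1_norm_polar:
  assumes f: "f holomorphic_on ball 0 1"
    and \<omega>_meas: "(\<lambda>r. indicator {0..<1} r * \<omega> r) \<in> borel_measurable borel"
    and \<omega>_nonneg: "\<And>r. 0 \<le> r \<Longrightarrow> r < 1 \<Longrightarrow> 0 \<le> \<omega> r"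
  shows "D1_norm \<omega> f = (\<integral>\<^sup>+r\<in>{0..<1}. ennreal (r * \<omega> r / pi * circle_integral (deriv f) r) \<partial>lborel) + ennreal (norm (f 0))"
proof -
  let ?h = "deriv f"
  define v where "v r = indicator {0..<1} r * \<omega> r" for r :: real
  have [measurable]: "v \<in> borel_measurable borel" using \<omega>_meas by (simp add: v_def[abs_def])
  have hc: "continuous_on (ball 0 1) ?h"
    using f by (intro holomorphic_on_imp_continuous_on holomorphic_deriv) auto
  define g where "g z = ennreal (norm (?h z) * \<omega> (cmod z) / pi) * indicator (ball 0 1) z" for z
  have "g z = ennreal ((indicator (ball 0 1) z *\<^sub>R norm (?h z)) * v (cmod z) / pi)" for z
    by (simp add: g_def v_def indicator_def)
  moreover have "(\<lambda>z. indicator (ball 0 1) z *\<^sub>R norm (?h z)) \<in> borel_measurable borel"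
    by (intro borel_measurable_continuous_on_indicator continuous_intros hc) auto
  ultimately have [measurable]: "g \<in> borel_measurable borel" by (simp add: cong: measurable_cong)
  have "(\<integral>\<^sup>+z. g z \<partial>lborel) = (\<integral>\<^sup>+r. (\<integral>\<^sup>+\<theta>\<in>{0..2*pi}. g (of_real r * cis \<theta>) \<partial>lborel) * ennreal (r * indicator {0..} r) \<partial>lborel)"
    by (rule nn_integral_polar) measurable
  also have "\<dots> = (\<integral>\<^sup>+r\<in>{0..<1}. ennreal (r * \<omega> r / pi * circle_integral ?h r) \<partial>lborel)"
  proof (rule nn_integral_cong)
    fix r :: real
    consider "r < 0" | "r \<ge> 1" | "0 \<le> r" "r < 1" by linarith
    then show "(\<integral>\<^sup>+\<theta>\<in>{0..2*pi}. g (of_real r * cis \<theta>) \<partial>lborel) * ennreal (r * indicator {0..} r) = ennreal (r * \<omega> r / pi * circle_integral ?h r) * indicator {0..<1} r"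
    proof cases
      case 3
      have "(\<integral>\<^sup>+\<theta>\<in>{0..2*pi}. g (of_real r * cis \<theta>) \<partial>lborel) = (\<integral>\<^sup>+\<theta>. ennreal (\<omega> r / pi) * (ennreal (norm (?h (of_real r * cis \<theta>))) * indicator {0..2*pi} \<theta>) \<partial>lborel)"
        using 3 \<omega>_nonneg[of r] by (intro nn_integral_cong) (auto simp: g_def norm_mult indicator_def ennreal_mult[symmetric] mult_ac)
      also have "\<dots> = ennreal (\<omega> r / pi) * (\<integral>\<^sup>+\<theta>\<in>{0..2*pi}. ennreal (norm (?h (of_real r * cis \<theta>))) \<partial>lborel)"
      proof (rule nn_integral_cmult)
        have "(\<lambda>\<theta>. norm (?h (of_real r * cis \<theta>))) \<in> borel_measurable borel"
          using 3 by (intro borel_measurable_continuous_onI continuous_intros continuous_on_circle hc) auto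
        then show "(\<lambda>\<theta>. ennreal (norm (?h (of_real r * cis \<theta>))) * indicator {0..2*pi} \<theta>) \<in> borel_measurable lborel"
          by measurable
      qed
      also have "\<dots> = ennreal (\<omega> r / pi) * ennreal (circle_integral ?h r)"
        using circle_nn_integral[OF hc, of "of_real r"] 3 by simp
      finally show ?thesis
        using 3 \<omega>_nonneg[of r] by (simp add: ennreal_mult[symmetric] circle_integral_nonneg mult_ac)
    next
      case 2
      then have "g (of_real r * cis \<theta>) = 0" for \<theta> by (simp add: g_def norm_mult)
      then show ?thesis using 2 by simp
    qed simp
  qed
  finally show ?thesis by (simp add: D1_norm_def g_def)
qed

text \<open>For increasing \<open>m\<close>, each superlevel set is \<open>{a..<1}\<close> or
  \<open>{a<..<1}\<close>. The tail inequality is thus the desired inequality on every level, and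
  Fubini adds up the levels.\<close>

lemma nn_integral_mono_on_tails:
  fixes u v :: "real \<Rightarrow> ennreal"
  assumes [measurable]: "u \<in> borel_measurable borel" "v \<in> borel_measurable borel"
    and m_meas: "(\<lambda>r. indicator {0..<1} r * m r) \<in> borel_measurable borel"
    and mono: "\<And>r s. 0 \<le> r \<Longrightarrow> r \<le> s \<Longrightarrow> s < 1 \<Longrightarrow> m r \<le> m s"
    and nonneg: "\<And>r. 0 \<le> r \<Longrightarrow> r < 1 \<Longrightarrow> (0::real) \<le> m r"
    and tails: "\<And>a. 0 \<le> a \<Longrightarrow> a < 1 \<Longrightarrow> (\<integral>\<^sup>+r\<in>{a..<1}. u r \<partial>lborel) \<le> (\<integral>\<^sup>+r\<in>{a..<1}. v r \<partial>lborel)"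
  shows "(\<integral>\<^sup>+r\<in>{0..<1}. u r * ennreal (m r) \<partial>lborel) \<le> (\<integral>\<^sup>+r\<in>{0..<1}. v r * ennreal (m r) \<partial>lborel)"
proof -
  define m' where "m' r = indicator {0..<1} r * m r" for r :: real
  have [measurable]: "m' \<in> borel_measurable borel" using m_meas by (simp add: m'_def[abs_def])
  have m': "0 \<le> m' r" for r using nonneg[of r] by (auto simp: m'_def indicator_def)
  \<comment> \<open>The conjunct \<open>0 \<le> t\<close> makes \<open>S t\<close> empty for
    negative t; without it \<open>S t\<close> would be the whole line there, since \<open>m'\<close>
    is nonnegative everywhere.\<close>
  define S where "S t = {r. 0 \<le> t \<and> t < m' r}" for t
  have layer: "(\<integral>\<^sup>+r\<in>{0..<1}. w r * ennreal (m r) \<partial>lborel) = (\<integral>\<^sup>+t. (\<integral>\<^sup>+r\<in>S t. w r \<partial>lborel) \<partial>lborel)"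
    if [measurable]: "w \<in> borel_measurable borel" for w
  proof -
    have "(\<integral>\<^sup>+r\<in>{0..<1}. w r * ennreal (m r) \<partial>lborel) = (\<integral>\<^sup>+r. w r * ennreal (m' r) \<partial>lborel)"
      by (intro nn_integral_cong) (auto simp: m'_def indicator_def)
    also have "\<dots> = (\<integral>\<^sup>+r. (\<integral>\<^sup>+t. w r * indicator {0..<m' r} t \<partial>lborel) \<partial>lborel)"
      using m' by (intro nn_integral_cong) (simp add: nn_integral_cmult)
    also have "\<dots> = (\<integral>\<^sup>+r. (\<integral>\<^sup>+t. (if 0 \<le> t \<and> t < m' r then w r else 0) \<partial>lborel) \<partial>lborel)"
      by (intro nn_integral_cong) (auto simp: indicator_def)
    also have "\<dots> = (\<integral>\<^sup>+t. (\<integral>\<^sup>+r. (if 0 \<le> t \<and> t < m' r then w r else 0) \<partial>lborel) \<partial>lborel)"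
      by (rule lborel_pair.Fubini') measurable
    also have "\<dots> = (\<integral>\<^sup>+t. (\<integral>\<^sup>+r\<in>S t. w r \<partial>lborel) \<partial>lborel)"
      by (intro nn_integral_cong) (auto simp: indicator_def S_def)
    finally show ?thesis .
  qed
  have "(\<integral>\<^sup>+r\<in>S t. u r \<partial>lborel) \<le> (\<integral>\<^sup>+r\<in>S t. v r \<partial>lborel)" for t
  proof (cases "S t = {}")
    case False
    have S01: "S t \<subseteq> {0..<1}" by (auto simp: S_def m'_def indicator_def split: if_splits)
    have up: "s \<in> S t" if "r \<in> S t" "r \<le> s" "s < 1" for r s
    proof -
      have "0 \<le> r" "r < 1" using S01 that by auto
      then show ?thesis using that mono[of r s] by (auto simp: S_def m'_def)
    qed
    define a where "a = Inf (S t)"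
    have bdd: "bdd_below (S t)" using S01 by (intro bdd_belowI[of _ 0]) auto
    have a: "0 \<le> a" "a < 1"
    proof -
      show "0 \<le> a" unfolding a_def using S01 False by (intro cInf_greatest) auto
      obtain r where "r \<in> S t" using False by auto
      then have "a \<le> r" "r < 1" using S01 bdd by (auto simp: a_def intro!: cInf_lower)
      then show "a < 1" by simp
    qed
    have lower: "S t \<subseteq> {a..<1}" using S01 bdd by (auto simp: a_def intro!: cInf_lower)
    have upper: "{a<..<1} \<subseteq> S t"
    proof
      fix s assume s: "s \<in> {a<..<1}"
      then obtain r where "r \<in> S t" "r < s" using cInf_lessD[OF False, of s] by (auto simp: a_def)
      then show "s \<in> S t" using up[of r s] s by auto
    qed
    have "(\<integral>\<^sup>+r\<in>S t. u r \<partial>lborel) \<le> (\<integral>\<^sup>+r\<in>{a..<1}. u r \<partial>lborel)"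
      using lower by (intro nn_integral_mono) (auto simp: indicator_def)
    also have "\<dots> \<le> (\<integral>\<^sup>+r\<in>{a..<1}. v r \<partial>lborel)" by (rule tails[OF a])
    \<comment> \<open>The infimum \<open>a\<close> may or may not belong to \<open>S t\<close>; a
      single point has measure 0.\<close>
    also have "\<dots> = (\<integral>\<^sup>+r\<in>{a<..<1}. v r \<partial>lborel)"
      by (intro nn_integral_cong_AE eventually_mono[OF AE_lborel_singleton[of a]]) (auto simp: indicator_def)
    also have "\<dots> \<le> (\<integral>\<^sup>+r\<in>S t. v r \<partial>lborel)"
      using upper by (intro nn_integral_mono) (auto simp: indicator_def)
    finally show ?thesis .
  qed simp
  then show ?thesis by (simp add: layer nn_integral_mono)
qed

section \<open>Integrability and tails of a radial weight\<close>

context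
  fixes \<omega> :: "real \<Rightarrow> real"
  assumes \<omega>: "radial_weight \<omega>"
begin

lemma weight_nonneg: "0 \<le> r \<Longrightarrow> r < 1 \<Longrightarrow> 0 \<le> \<omega> r"
  using \<omega> by (auto simp: radial_weight_def)

lemma weight_measurable: "(\<lambda>r. indicator {0..<1} r * \<omega> r) \<in> borel_measurable borel"
  using \<omega> by (auto simp: radial_weight_def set_integrable_def dest!: borel_measurable_integrable)

lemma omega_hat_pos: "0 \<le> r \<Longrightarrow> r < 1 \<Longrightarrow> 0 < omega_hat \<omega> r"
  using \<omega> by (auto simp: radial_weight_def)

lemma weight_set_integrable: "A \<in> sets borel \<Longrightarrow> A \<subseteq> {0..<1} \<Longrightarrow> set_integrable lborel A \<omega>"
  using \<omega> by (auto simp: radial_weight_def intro: set_integrable_subset)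

lemma bounded_weight_set_integrable:
  fixes \<phi> :: "real \<Rightarrow> real"
  assumes A: "A \<in> sets borel" "A \<subseteq> {0..<1}" and \<phi>: "continuous_on {0..<1} \<phi>"
    and bound: "\<And>r. 0 \<le> r \<Longrightarrow> r < 1 \<Longrightarrow> \<bar>\<phi> r\<bar> \<le> B"
  shows "set_integrable lborel A (\<lambda>r. \<phi> r * \<omega> r)"
proof (rule set_integrable_subset[OF _ _ A(2)])
  have [measurable]: "(\<lambda>r. indicator {0..<1} r *\<^sub>R \<phi> r) \<in> borel_measurable borel"
    by (intro borel_measurable_continuous_on_indicator \<phi>) auto
  note weight_measurable[measurable]
  show "set_integrable lborel {0..<1} (\<lambda>r. \<phi> r * \<omega> r)"
  proof (rule set_integrable_bound)
    show "set_integrable lborel {0..<1} (\<lambda>r. B * \<omega> r)"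
      using weight_set_integrable[of "{0..<1}"] by simp
    have "(\<lambda>r. indicator {0..<1} r *\<^sub>R (\<phi> r * \<omega> r)) = (\<lambda>r. (indicator {0..<1} r *\<^sub>R \<phi> r) * (indicator {0..<1} r * \<omega> r))"
      by (auto simp: indicator_def)
    moreover have "(\<lambda>r. (indicator {0..<1} r *\<^sub>R \<phi> r) * (indicator {0..<1} r * \<omega> r)) \<in> borel_measurable borel"
      by measurable
    ultimately show "set_borel_measurable lborel {0..<1} (\<lambda>r. \<phi> r * \<omega> r)"
      unfolding set_borel_measurable_def by (simp del: real_scaleR_def)
    show "AE x in lborel. x \<in> {0..<1} \<longrightarrow> norm (\<phi> x * \<omega> x) \<le> norm (B * \<omega> x)"
    proof (intro AE_I2 impI)
      fix x :: real assume "x \<in> {0..<1}"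
      then have "\<bar>\<phi> x\<bar> \<le> \<bar>B\<bar>" using bound[of x] by auto
      then show "norm (\<phi> x * \<omega> x) \<le> norm (B * \<omega> x)" by (simp add: abs_mult mult_right_mono)
    qed
  qed
qed (use A in auto)

lemma nn_integral_bounded_weight:
  fixes \<phi> :: "real \<Rightarrow> real"
  assumes A: "A \<in> sets borel" "A \<subseteq> {0..<1}" and \<phi>: "continuous_on {0..<1} \<phi>"
    and bound: "\<And>r. 0 \<le> r \<Longrightarrow> r < 1 \<Longrightarrow> 0 \<le> \<phi> r \<and> \<phi> r \<le> B"
  shows "(\<integral>\<^sup>+r\<in>A. ennreal (\<phi> r * \<omega> r) \<partial>lborel) = ennreal (LINT r:A|lborel. \<phi> r * \<omega> r)"
proof -
  have "set_integrable lborel A (\<lambda>r. \<phi> r * \<omega> r)"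
    using bound by (intro bounded_weight_set_integrable[OF A \<phi>, of B]) (auto simp: abs_of_nonneg)
  then have "(\<integral>\<^sup>+r. ennreal (indicator A r *\<^sub>R (\<phi> r * \<omega> r)) \<partial>lborel) = ennreal (LINT r|lborel. indicator A r *\<^sub>R (\<phi> r * \<omega> r))"
    using A bound weight_nonneg unfolding set_integrable_def
    by (intro nn_integral_eq_integral) (auto simp: indicator_def intro!: AE_I2)
  also have "(\<integral>\<^sup>+r. ennreal (indicator A r *\<^sub>R (\<phi> r * \<omega> r)) \<partial>lborel) = (\<integral>\<^sup>+r\<in>A. ennreal (\<phi> r * \<omega> r) \<partial>lborel)"
    by (intro nn_integral_cong) (auto simp: indicator_def)
  finally show ?thesis by (simp add: set_lebesgue_integral_def)
qed

lemma nn_integral_omega_hat: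
  "0 \<le> r \<Longrightarrow> (\<integral>\<^sup>+s\<in>{r..<1}. ennreal (\<omega> s) \<partial>lborel) = ennreal (omega_hat \<omega> r)"
  using nn_integral_bounded_weight[of "{r..<1}" "\<lambda>_. 1" 1] by (auto simp: omega_hat_def)

lemma omega_hat_antimono:
  assumes "0 \<le> r" "r \<le> s" "s < 1"
  shows "omega_hat \<omega> s \<le> omega_hat \<omega> r"
proof -
  have "ennreal (omega_hat \<omega> s) \<le> ennreal (omega_hat \<omega> r)"
    using assms by (subst (1 2) nn_integral_omega_hat[symmetric])
      (auto intro!: nn_integral_mono simp: indicator_def)
  then show ?thesis using omega_hat_pos[of r] assms by (subst (asm) ennreal_le_iff) auto
qed

lemma D1_norm_one_le:
  assumes C: "\<And>r. 0 \<le> r \<Longrightarrow> r < 1 \<Longrightarrow> 1 - r \<le> C * omega_hat \<omega> r" and C1: "C \<ge> 1"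
    and f: "f holomorphic_on ball 0 1"
  shows "D1_norm (\<lambda>_. 1) f \<le> ennreal (4 * C) * D1_norm \<omega> f"
proof -
  let ?m = "\<lambda>r. circle_integral (deriv f) r / pi"
  have df: "deriv f holomorphic_on ball 0 1" using f by (intro holomorphic_deriv) auto
  define v where "v r = indicator {0..<1} r * \<omega> r" for r :: real
  have [measurable]: "v \<in> borel_measurable borel" using weight_measurable by (simp add: v_def[abs_def])
  have D: "D1_norm w f = (\<integral>\<^sup>+r\<in>{0..<1}. ennreal (r * w r) * ennreal (?m r) \<partial>lborel) + ennreal (norm (f 0))"
    if "(\<lambda>r. indicator {0..<1} r * w r) \<in> borel_measurable borel" "\<And>r. 0 \<le> r \<Longrightarrow> r < 1 \<Longrightarrow> 0 \<le> w r" for w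
    using that by (subst D1_norm_polar[OF f])
      (auto intro!: nn_integral_cong arg_cong2[where f="(+)"] simp: indicator_def ennreal_mult[symmetric] circle_integral_nonneg)
  have "(\<integral>\<^sup>+r\<in>{0..<1}. ennreal (r * 1) * ennreal (?m r) \<partial>lborel) \<le> (\<integral>\<^sup>+r\<in>{0..<1}. ennreal (4 * C * (r * v r)) * ennreal (?m r) \<partial>lborel)"
  proof (rule nn_integral_mono_on_tails)
    have "(\<lambda>r. indicator {0..<1} r *\<^sub>R ?m r) \<in> borel_measurable borel"
      by (intro borel_measurable_continuous_on_indicator continuous_intros continuous_on_circle_integral holomorphic_on_imp_continuous_on df) auto
    then show "(\<lambda>r. indicator {0..<1} r * ?m r) \<in> borel_measurable borel" by simp
    show "?m r \<le> ?m s" if "0 \<le> r" "r \<le> s" "s < 1" for r s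
      using circle_integral_mono[OF df that] by (simp add: divide_right_mono)
    show "0 \<le> ?m r" for r by (simp add: circle_integral_nonneg)
    fix a :: real assume a: "0 \<le> a" "a < 1"
    \<comment> \<open>The polar density contains a factor r that degenerates at 0. On
      \<open>{b..<1}\<close> one has \<open>2 * r \<ge> 1\<close>, and replacing \<open>a\<close> by
      \<open>b\<close> at most halves the distance to 1. These two factors 2 make up the constant
      \<open>4 * C\<close>.\<close>
    define b where "b = max a (1/2)"
    have b: "a \<le> b" "1/2 \<le> b" "b < 1" "1 - a \<le> 2 * (1 - b)" using a by (auto simp: b_def)
    have "(\<integral>\<^sup>+r\<in>{a..<1}. ennreal (r * 1) \<partial>lborel) \<le> (\<integral>\<^sup>+r. indicator {a..<1} r \<partial>lborel)"
      by (intro nn_integral_mono) (auto simp: indicator_def ennreal_le_1)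
    also have "\<dots> = ennreal (1 - a)" using a by simp
    also have "\<dots> \<le> ennreal (2 * C * omega_hat \<omega> b)"
      using b C[of b] by (intro ennreal_leI) auto
    also have "\<dots> = ennreal (2 * C) * (\<integral>\<^sup>+r\<in>{b..<1}. ennreal (\<omega> r) \<partial>lborel)"
      using C1 b omega_hat_pos[of b] by (simp add: nn_integral_omega_hat ennreal_mult')
    also have "\<dots> = ennreal (2 * C) * (\<integral>\<^sup>+r\<in>{b..<1}. ennreal (v r) \<partial>lborel)"
      using b by (intro arg_cong[where f="(*) (ennreal (2 * C))"] nn_integral_cong) (auto simp: v_def split: split_indicator)
    also have "\<dots> = (\<integral>\<^sup>+r. ennreal (2 * C) * (ennreal (v r) * indicator {b..<1} r) \<partial>lborel)"
      by (rule nn_integral_cmult[symmetric]) measurable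
    also have "\<dots> \<le> (\<integral>\<^sup>+r\<in>{a..<1}. ennreal (4 * C * (r * v r)) \<partial>lborel)"
    proof (intro nn_integral_mono)
      fix r
      show "ennreal (2 * C) * (ennreal (v r) * indicator {b..<1} r) \<le> ennreal (4 * C * (r * v r)) * indicator {a..<1} r"
      proof (cases "r \<in> {b..<1}")
        case True
        then have "0 \<le> v r" using b weight_nonneg[of r] by (auto simp: v_def)
        then have "2 * C * v r * 1 \<le> 2 * C * v r * (2 * r)"
          using True b C1 by (intro mult_left_mono) auto
        then show ?thesis using True b C1 \<open>0 \<le> v r\<close>
          by (simp add: ennreal_mult'[symmetric] ennreal_leI mult_ac)
      qed simp
    qed
    finally show "(\<integral>\<^sup>+r\<in>{a..<1}. ennreal (r * 1) \<partial>lborel) \<le> (\<integral>\<^sup>+r\<in>{a..<1}. ennreal (4 * C * (r * v r)) \<partial>lborel)" .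
  qed measurable
  also have "\<dots> = (\<integral>\<^sup>+r. ennreal (4 * C) * (ennreal (r * v r * ?m r * indicator {0..<1} r)) \<partial>lborel)"
    using C1 weight_nonneg
    by (intro nn_integral_cong) (auto simp: indicator_def v_def ennreal_mult[symmetric] circle_integral_nonneg mult_ac)
  also have "\<dots> = ennreal (4 * C) * (\<integral>\<^sup>+r. ennreal (r * v r * ?m r * indicator {0..<1} r) \<partial>lborel)"
  proof (rule nn_integral_cmult)
    have "(\<lambda>r. indicator {0..<1} r *\<^sub>R ?m r) \<in> borel_measurable borel"
      by (intro borel_measurable_continuous_on_indicator continuous_intros continuous_on_circle_integral holomorphic_on_imp_continuous_on df) auto
    then have [measurable]: "(\<lambda>r. ?m r * indicator {0..<1} r) \<in> borel_measurable borel" by (simp add: mult.commute)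
    show "(\<lambda>r. ennreal (r * v r * ?m r * indicator {0..<1} r)) \<in> borel_measurable lborel"
      unfolding mult.assoc by measurable
  qed
  also have "(\<integral>\<^sup>+r. ennreal (r * v r * ?m r * indicator {0..<1} r) \<partial>lborel) = (\<integral>\<^sup>+r\<in>{0..<1}. ennreal (r * \<omega> r) * ennreal (?m r) \<partial>lborel)"
    using weight_nonneg
    by (intro nn_integral_cong) (auto simp: indicator_def v_def ennreal_mult[symmetric] circle_integral_nonneg)
  finally have "(\<integral>\<^sup>+r\<in>{0..<1}. ennreal (r * 1) * ennreal (?m r) \<partial>lborel)
     \<le> ennreal (4 * C) * (\<integral>\<^sup>+r\<in>{0..<1}. ennreal (r * \<omega> r) * ennreal (?m r) \<partial>lborel)" .
  moreover have "ennreal (norm (f 0)) \<le> ennreal (4 * C) * ennreal (norm (f 0))"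
    using C1 mult_right_mono[of 1 "4*C" "norm (f 0)"] by (simp add: ennreal_mult[symmetric] ennreal_leI)
  ultimately show ?thesis
    by (subst (1 2) D) (auto simp: weight_measurable weight_nonneg distrib_left intro: add_mono)
qed

end

text \<open>Parametrising the radius by \<rho>^2 serves two ends:
  \<open>norm_le_circle_integral\<close> bounds the derivative at \<rho>^2 z by the circle of radius
  \<rho>, and the chain rule supplies the factor 2 \<rho>, which is the r of the area
  element.\<close>

lemma Tg_id_norm_le:
  assumes f: "f holomorphic_on ball 0 1" and z: "z \<in> ball 0 1"
  shows "ennreal (norm (Tg (\<lambda>w. w) f z)) \<le> 2 * D1_norm (\<lambda>_. 1) f"
proof -
  let ?h = "deriv f"
  obtain F where F: "\<And>w. w \<in> ball 0 1 \<Longrightarrow> (F has_field_derivative f w) (at w)"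
    using holomorphic_convex_primitive'[OF _ _ f] by (auto simp: at_within_open[OF _ open_ball])
  have df: "?h holomorphic_on ball 0 1" using f by (intro holomorphic_deriv) auto
  have hc: "continuous_on (ball 0 1) ?h" using df by (rule holomorphic_on_imp_continuous_on)
  have "(f has_contour_integral F (pathfinish (linepath 0 z)) - F (pathstart (linepath 0 z))) (linepath 0 z)"
  proof (rule contour_integral_primitive[where S="ball 0 1"])
    show "path_image (linepath 0 z) \<subseteq> ball 0 1"
      using z closed_segment_subset[of 0 "ball 0 1" z] by auto
  qed (auto intro!: has_field_derivative_at_within F simp del: linepath_0)
  then have T: "Tg (\<lambda>w. w) f z = F z - F 0"
    by (simp add: Tg_def contour_integral_unique)
  have in_ball: "of_real \<rho> ^ 2 * z \<in> ball 0 1" if "0 \<le> \<rho>" "\<rho> \<le> 1" for \<rho>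
  proof -
    have "cmod (of_real \<rho> ^ 2 * z) \<le> 1 * cmod z"
      unfolding norm_mult using that by (intro mult_right_mono) (auto simp: norm_power power_le_one)
    then show ?thesis using z by simp
  qed
  \<comment> \<open>An antiderivative found by parts: the derivative of the factor 1 - w^2
    contributes -2 w z f, which cancels the derivative 2 w z f of the second summand. Only the term
    with f' remains.\<close>
  define \<Phi> where "\<Phi> w = (1 - w\<^sup>2) * z * f (w\<^sup>2 * z) + F (w\<^sup>2 * z)" for w
  define k where "k \<rho> = 2 * of_real \<rho> * (1 - (of_real \<rho>)\<^sup>2) * z\<^sup>2 * ?h ((of_real \<rho>)\<^sup>2 * z)" for \<rho> :: real
  have "(k has_integral \<Phi> (of_real 1) - \<Phi> (of_real 0)) {0..1}"
  proof (rule fundamental_theorem_of_calculus)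
    fix \<rho> :: real assume "\<rho> \<in> {0..1}"
    then have b: "(of_real \<rho>)\<^sup>2 * z \<in> ball 0 1" using in_ball by auto
    have i: "((\<lambda>w. w\<^sup>2 * z) has_field_derivative 2 * of_real \<rho> * z) (at (of_real \<rho>))"
      by (auto intro!: derivative_eq_intros)
    have "(f has_field_derivative ?h ((of_real \<rho>)\<^sup>2 * z)) (at ((of_real \<rho>)\<^sup>2 * z))"
      using f b by (intro holomorphic_derivI[of _ "ball 0 1"]) auto
    note fd = DERIV_chain2[OF this i] and Fd = DERIV_chain2[OF F[OF b] i]
    have "(\<Phi> has_field_derivative k \<rho>) (at (of_real \<rho>))"
      unfolding \<Phi>_def k_def
      by (rule derivative_eq_intros fd Fd refl)+ (simp add: algebra_simps power2_eq_square)
    then show "((\<lambda>\<rho>. \<Phi> (of_real \<rho>)) has_vector_derivative k \<rho>) (at \<rho> within {0..1})"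
      by (rule has_vector_derivative_real_field)
  qed simp
  then have I: "(k has_integral F z - F 0 - z * f 0) {0..1}" by (simp add: \<Phi>_def algebra_simps)
  have kc: "continuous_on {0..1} k"
    unfolding k_def using in_ball by (intro continuous_intros continuous_on_compose2[OF hc]) auto
  have I': "((\<lambda>\<rho>. norm (k \<rho>)) has_integral integral {0..1} (\<lambda>\<rho>. norm (k \<rho>))) {0..1}"
    by (intro integrable_integral integrable_continuous_real continuous_intros kc)
  define X where "X = (\<integral>\<^sup>+r\<in>{0..<1}. ennreal (r * 1 / pi * circle_integral ?h r) \<partial>lborel)"
  have "norm (F z - F 0 - z * f 0) \<le> integral {0..1} (\<lambda>\<rho>. norm (k \<rho>))"
    using has_integral_norm_bound_integral_component[OF I I', of 1] by simp
  then have "ennreal (norm (F z - F 0 - z * f 0)) \<le> ennreal (integral {0..1} (\<lambda>\<rho>. norm (k \<rho>)))"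
    by (rule ennreal_leI)
  also have "\<dots> = (\<integral>\<^sup>+\<rho>\<in>{0..1}. ennreal (norm (k \<rho>)) \<partial>lborel)"
    using I' by (intro nn_integral_has_integral_lebesgue'[symmetric]) auto
  also have "\<dots> \<le> (\<integral>\<^sup>+r. ennreal 2 * (ennreal (r * 1 / pi * circle_integral ?h r) * indicator {0..<1} r) \<partial>lborel)"
  proof (intro nn_integral_mono)
    fix \<rho> :: real
    consider "\<rho> \<notin> {0..1}" | "\<rho> = 0" | "\<rho> = 1" | "0 < \<rho>" "\<rho> < 1" by force
    then show "ennreal (norm (k \<rho>)) * indicator {0..1} \<rho> \<le> ennreal 2 * (ennreal (\<rho> * 1 / pi * circle_integral ?h \<rho>) * indicator {0..<1} \<rho>)"
    proof cases
      case 4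
      have "norm (1 - (of_real \<rho>)\<^sup>2 :: complex) = (1 - \<rho>) * (1 + \<rho>)"
      proof -
        have "(1 - (of_real \<rho>)\<^sup>2 :: complex) = of_real ((1 - \<rho>) * (1 + \<rho>))"
          by (simp add: algebra_simps power2_eq_square)
        then show ?thesis using 4 by (simp only: norm_of_real) simp
      qed
      then have "norm (k \<rho>) = 2 * \<rho> * ((1 - \<rho>) * (1 + \<rho>)) * (cmod z)\<^sup>2 * norm (?h ((of_real \<rho>)\<^sup>2 * z))"
        using 4 by (simp add: k_def norm_mult norm_power)
      \<comment> \<open>Here 1 + \<rho> is bounded by 2 and \<open>cmod z\<close> by 1, leaving
        exactly the multiple of 1 - \<rho> that \<open>norm_le_circle_integral\<close>
        absorbs.\<close>
      also have "\<dots> \<le> 2 * \<rho> * ((1 - \<rho>) * 2) * 1 * norm (?h ((of_real \<rho>)\<^sup>2 * z))"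
        using 4 z by (intro mult_right_mono mult_mono mult_left_mono) (auto simp: power_le_one)
      also have "\<dots> = 2 * \<rho> / pi * (2 * pi * (1 - \<rho>) * norm (?h (of_real (\<rho>\<^sup>2) * z)))"
        by simp
      also have "\<dots> \<le> 2 * \<rho> / pi * circle_integral ?h \<rho>"
        using 4 z by (intro mult_left_mono norm_le_circle_integral df) auto
      finally show ?thesis using 4 by (simp add: ennreal_mult[symmetric] circle_integral_nonneg ennreal_leI del: ennreal_numeral)
    qed (auto simp: k_def)
  qed
  also have "\<dots> = ennreal 2 * X"
  proof -
    have "(\<lambda>r. indicator {0..<1} r *\<^sub>R (r * 1 / pi * circle_integral ?h r)) \<in> borel_measurable borel"
      by (intro borel_measurable_continuous_on_indicator continuous_intros continuous_on_circle_integral hc) auto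
    then have "(\<lambda>r. ennreal (indicator {0..<1} r *\<^sub>R (r * 1 / pi * circle_integral ?h r))) \<in> borel_measurable borel"
      by measurable
    also have "(\<lambda>r. ennreal (indicator {0..<1} r *\<^sub>R (r * 1 / pi * circle_integral ?h r))) = (\<lambda>r. ennreal (r * 1 / pi * circle_integral ?h r) * indicator {0..<1} r)"
      by (auto simp: indicator_def)
    finally show ?thesis unfolding X_def by (intro nn_integral_cmult) simp
  qed
  finally have bound: "ennreal (norm (F z - F 0 - z * f 0)) \<le> 2 * X" by simp
  have "norm (F z - F 0) \<le> norm (F z - F 0 - z * f 0) + norm (z * f 0)"
    using norm_triangle_ineq[of "F z - F 0 - z * f 0" "z * f 0"] by simp
  also have "norm (z * f 0) \<le> norm (f 0)" using z by (simp add: norm_mult mult_left_le_one_le)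
  finally have "ennreal (norm (F z - F 0)) \<le> ennreal (norm (F z - F 0 - z * f 0)) + ennreal (norm (f 0))"
    by (subst ennreal_plus[symmetric]) (auto intro: ennreal_leI simp del: ennreal_plus)
  also have "\<dots> \<le> 2 * X + 2 * ennreal (norm (f 0))"
    using mult_right_mono[of "1::ennreal" 2 "ennreal (norm (f 0))"] by (intro add_mono bound) auto
  also have "\<dots> = 2 * D1_norm (\<lambda>_. 1) f"
    by (subst D1_norm_polar[OF f]) (auto simp: X_def distrib_left)
  finally show ?thesis unfolding T .
qed

section \<open>Doubling weights and moments\<close>

text \<open>For \<open>cmod \<alpha> = a\<close> this is the maximum over \<open>cmod z = s\<close>
  of the modulus of the quotient whose power is \<open>kernel_fun\<close>. It exceeds 1/2 for a <= s
  < 1 and becomes small once 1 - s is large compared with 1 - a.\<close>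

definition kernel_ratio :: "real \<Rightarrow> real \<Rightarrow> real" where
  "kernel_ratio a s = (1 - a) / (1 - a * s)"

lemma one_minus_mult_pos:
  fixes a s :: real
  assumes "0 \<le> a" "a < 1" "0 \<le> s" "s < 1"
  shows "0 < 1 - a * s" "1 - a \<le> 1 - a * s"
proof -
  have "a * s \<le> a" using assms by (simp add: mult_left_le)
  then show "0 < 1 - a * s" "1 - a \<le> 1 - a * s" using assms by auto
qed

lemma kernel_ratio_bounds:
  assumes "0 \<le> a" "a < 1" "0 \<le> s" "s < 1"
  shows "0 \<le> kernel_ratio a s" "kernel_ratio a s \<le> 1" "1 - a \<le> kernel_ratio a s"
proof -
  note p = one_minus_mult_pos[OF assms]
  show "0 \<le> kernel_ratio a s" "kernel_ratio a s \<le> 1"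
    using p assms(2) by (simp_all add: kernel_ratio_def del: diff_gt_0_iff_gt)
  have "(1 - a) * (1 - a * s) \<le> 1 - a" using assms by (intro mult_left_le) auto
  then show "1 - a \<le> kernel_ratio a s"
    unfolding kernel_ratio_def by (subst pos_le_divide_eq[OF p(1)])
qed

lemma continuous_on_kernel_ratio:
  assumes "0 \<le> a" "a < 1"
  shows "continuous_on {0..<1} (\<lambda>s. kernel_ratio a s ^ \<gamma>)"
  unfolding kernel_ratio_def using one_minus_mult_pos[OF assms]
  by (intro continuous_intros) (auto simp: less_le)

text \<open>Passing to the midpoint halves the numerator 1 - a, while for s <= a the denominator
  keeps at least 3/4 of its size; hence 2/3. The 3/4 amounts to s (1 - a) <= 1 - s.\<close>

lemma kernel_ratio_midpoint:
  assumes a: "0 \<le> a" "a < 1" and s: "0 \<le> s" "s \<le> a"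
  shows "kernel_ratio ((1 + a) / 2) s \<le> 2/3 * kernel_ratio a s"
proof -
  have pos: "0 < 1 - a * s" "0 < 1 - (1 + a) / 2 * s"
    using one_minus_mult_pos[of a s] one_minus_mult_pos[of "(1 + a) / 2" s] assms by auto
  have "s * (1 - a) \<le> 1 * (1 - s)"
    using assms mult_mono[of s 1 "1 - a" "1 - s"] by simp
  then have "3 * (1 - a * s) \<le> 4 * (1 - (1 + a) / 2 * s)"
    by (simp add: algebra_simps)
  then have "(1 - a) * (3 * (1 - a * s)) \<le> (1 - a) * (4 * (1 - (1 + a) / 2 * s))"
    using a by (intro mult_left_mono) auto
  then show ?thesis
    using pos by (simp add: kernel_ratio_def divide_simps) (simp add: algebra_simps)
qed

text \<open>With x = n (1 - s), the power s^n is at most exp (-x), which decays faster than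
  (\<gamma> / (1 + x))^\<gamma>. The kernel ratio at 1 - 1/n equals 1 / (x + s), so it is at least 1
  / (1 + x). The constant \<gamma>^\<gamma> comes from 1 + x <= \<gamma> (1 + x / \<gamma>) <=
  \<gamma> exp (x / \<gamma>).\<close>

lemma power_le_kernel_ratio:
  fixes n \<gamma> :: nat
  assumes n: "n \<ge> 1" and \<gamma>: "\<gamma> \<ge> 1" and s: "0 \<le> s" "s < 1"
  shows "s ^ n \<le> real \<gamma> ^ \<gamma> * kernel_ratio (1 - 1 / real n) s ^ \<gamma>"
proof -
  define x where "x = real n * (1 - s)"
  have x: "x \<ge> 0" using s by (simp add: x_def)
  have "s ^ n \<le> exp (s - 1) ^ n" using s exp_ge_add_one_self[of "s - 1"] by (intro power_mono) auto
  also have "\<dots> = exp (- x)" by (simp add: x_def algebra_simps flip: exp_of_nat_mult)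
  also have "\<dots> \<le> real \<gamma> ^ \<gamma> / (1 + x) ^ \<gamma>"
  proof -
    have "1 + x \<le> \<gamma> * (1 + x / \<gamma>)" using \<gamma> by (simp add: field_simps)
    also have "\<dots> \<le> \<gamma> * exp (x / \<gamma>)" using exp_ge_add_one_self by (intro mult_left_mono) auto
    finally have "(1 + x) ^ \<gamma> \<le> (\<gamma> * exp (x / \<gamma>)) ^ \<gamma>" using x by (intro power_mono) auto
    also have "\<dots> = real \<gamma> ^ \<gamma> * exp x" using \<gamma> by (simp add: power_mult_distrib flip: exp_of_nat_mult)
    finally show ?thesis using x by (simp add: exp_minus field_simps)
  qed
  also have "\<dots> = real \<gamma> ^ \<gamma> * (1 / (1 + x)) ^ \<gamma>" by (simp add: power_divide)
  also have "\<dots> \<le> real \<gamma> ^ \<gamma> * kernel_ratio (1 - 1 / real n) s ^ \<gamma>"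
  proof (intro mult_left_mono power_mono)
    have "0 < x" using s n by (simp add: x_def)
    then have "0 < x + s" using s by simp
    moreover have "kernel_ratio (1 - 1 / real n) s = 1 / (x + s)"
      using n by (simp add: kernel_ratio_def x_def field_simps)
    ultimately show "1 / (1 + x) \<le> kernel_ratio (1 - 1 / real n) s" using s x by (simp add: frac_le)
  qed (use x in auto)
  finally show ?thesis .
qed

context
  fixes \<omega> :: "real \<Rightarrow> real"
  assumes \<omega>: "radial_weight \<omega>"
begin

lemmas weight_facts = weight_nonneg[OF \<omega>] omega_hat_pos[OF \<omega>] omega_hat_antimono[OF \<omega>]

lemma kernel_weight_measurable:
  assumes "0 \<le> a" "a < 1"
  shows "(\<lambda>s. ennreal (kernel_ratio a s ^ \<gamma> * \<omega> s) * indicator {0..<1} s) \<in> borel_measurable borel"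
proof -
  have "set_integrable lborel {0..<1} (\<lambda>s. kernel_ratio a s ^ \<gamma> * \<omega> s)"
    using kernel_ratio_bounds[OF assms]
    by (intro bounded_weight_set_integrable[OF \<omega>, where B=1] continuous_on_kernel_ratio assms) (auto simp: power_le_one)
  then have "(\<lambda>s. indicator {0..<1} s *\<^sub>R (kernel_ratio a s ^ \<gamma> * \<omega> s)) \<in> borel_measurable borel"
    by (auto simp: set_integrable_def dest!: borel_measurable_integrable)
  then have "(\<lambda>s. ennreal (indicator {0..<1} s *\<^sub>R (kernel_ratio a s ^ \<gamma> * \<omega> s))) \<in> borel_measurable borel"
    by measurable
  also have "(\<lambda>s. ennreal (indicator {0..<1} s *\<^sub>R (kernel_ratio a s ^ \<gamma> * \<omega> s))) = (\<lambda>s. ennreal (kernel_ratio a s ^ \<gamma> * \<omega> s) * indicator {0..<1} s)"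
    by (auto simp: indicator_def)
  finally show ?thesis .
qed

text \<open>Passing from \<open>a\<close> to \<open>(1 + a) / 2\<close> costs the doubling constant \<open>C\<close> on the right-hand side but
  gains a factor \<open>(2/3) ^ \<gamma>\<close> on the part \<open>s < a\<close>, so \<open>(2/3) ^ \<gamma> * C < 1/2\<close> lets the induction close.\<close>

lemma kernel_weight_bound:
  assumes "D_hat \<omega>"
  obtains \<gamma> :: nat and K :: real where "\<gamma> \<ge> 1" "K > 0"
    "\<And>a. 0 \<le> a \<Longrightarrow> a < 1 \<Longrightarrow> (\<integral>\<^sup>+s\<in>{0..<1}. ennreal (kernel_ratio a s ^ \<gamma> * \<omega> s) \<partial>lborel) \<le> ennreal (K * omega_hat \<omega> a)"
proof -
  obtain C where C: "C \<ge> 1" "\<And>r. 0 \<le> r \<Longrightarrow> r < 1 \<Longrightarrow> omega_hat \<omega> r \<le> C * omega_hat \<omega> ((1 + r) / 2)"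
    using assms by (auto simp: D_hat_def)
  obtain \<gamma> :: nat where \<gamma>: "(2/3) ^ \<gamma> < 1 / (2 * C)"
    using real_arch_pow_inv[of "1 / (2 * C)" "2/3"] C by auto
  have \<gamma>1: "\<gamma> \<ge> 1"
  proof (rule ccontr)
    assume "\<not> 1 \<le> \<gamma>"
    then have "\<gamma> = 0" by simp
    then show False using \<gamma> C by (simp add: field_simps)
  qed
  define \<phi> where "\<phi> a = (\<integral>\<^sup>+s\<in>{0..<1}. ennreal (kernel_ratio a s ^ \<gamma> * \<omega> s) \<partial>lborel)" for a
  have triv: "\<phi> a \<le> ennreal (omega_hat \<omega> 0)" if "0 \<le> a" "a < 1" for a
  proof -
    have "\<phi> a \<le> (\<integral>\<^sup>+s\<in>{0..<1}. ennreal (\<omega> s) \<partial>lborel)"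
      unfolding \<phi>_def
    proof (intro nn_integral_mono)
      fix s
      show "ennreal (kernel_ratio a s ^ \<gamma> * \<omega> s) * indicator {0..<1} s \<le> ennreal (\<omega> s) * indicator {0..<1} s"
        using kernel_ratio_bounds[OF that, of s] weight_facts(1)[of s]
        by (auto simp: indicator_def power_le_one intro!: ennreal_leI mult_left_le_one_le)
    qed
    then show ?thesis using nn_integral_omega_hat[OF \<omega>, of 0] by simp
  qed
  have step: "\<phi> ((1 + a) / 2) \<le> ennreal ((2/3) ^ \<gamma>) * \<phi> a + ennreal (omega_hat \<omega> a)" if a: "0 \<le> a" "a < 1" for a
  proof -
    have [measurable]: "(\<lambda>s. ennreal (kernel_ratio a s ^ \<gamma> * \<omega> s) * indicator {0..<1} s) \<in> borel_measurable borel"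
      by (rule kernel_weight_measurable[OF a])
    \<comment> \<open>With exponent 0 the kernel factor is 1, which leaves the measurability of
      \<open>\<omega>\<close> itself on \<open>{0..<1}\<close>.\<close>
    have "(\<lambda>s. ennreal (kernel_ratio 0 s ^ 0 * \<omega> s) * indicator {0..<1} s) \<in> borel_measurable borel"
      by (rule kernel_weight_measurable) auto
    then have [measurable]: "(\<lambda>s. ennreal (\<omega> s) * indicator {0..<1} s) \<in> borel_measurable borel" by simp
    have "\<phi> ((1 + a) / 2) \<le> (\<integral>\<^sup>+s. ennreal ((2/3) ^ \<gamma>) * (ennreal (kernel_ratio a s ^ \<gamma> * \<omega> s) * indicator {0..<1} s)
        + (ennreal (\<omega> s) * indicator {0..<1} s) * indicator {a..<1} s \<partial>lborel)"
      unfolding \<phi>_def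
    proof (intro nn_integral_mono)
      fix s
      let ?a' = "(1 + a) / 2"
      consider "s \<notin> {0..<1}" | "0 \<le> s" "s < 1" "s < a" | "0 \<le> s" "s < 1" "a \<le> s" by force
      then show "ennreal (kernel_ratio ?a' s ^ \<gamma> * \<omega> s) * indicator {0..<1} s
         \<le> ennreal ((2/3) ^ \<gamma>) * (ennreal (kernel_ratio a s ^ \<gamma> * \<omega> s) * indicator {0..<1} s) + (ennreal (\<omega> s) * indicator {0..<1} s) * indicator {a..<1} s"
      proof cases
        case 2
        have "kernel_ratio ?a' s ^ \<gamma> \<le> (2/3 * kernel_ratio a s) ^ \<gamma>"
          using 2 a kernel_ratio_bounds[of ?a' s] by (intro power_mono kernel_ratio_midpoint) auto
        then have "kernel_ratio ?a' s ^ \<gamma> * \<omega> s \<le> (2/3) ^ \<gamma> * (kernel_ratio a s ^ \<gamma> * \<omega> s)"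
          using weight_facts(1)[of s] 2 unfolding power_mult_distrib mult.assoc[symmetric] by (intro mult_right_mono) auto
        then show ?thesis
          using 2 kernel_ratio_bounds[OF a, of s] weight_facts(1)[of s] by (simp add: ennreal_mult[symmetric] ennreal_leI del: ennreal_power)
      next
        case 3
        have "kernel_ratio ?a' s ^ \<gamma> * \<omega> s \<le> \<omega> s"
          using 3 a kernel_ratio_bounds[of ?a' s] weight_facts(1)[of s] by (intro mult_left_le_one_le) (auto simp: power_le_one)
        then show ?thesis using 3 by (auto intro!: ennreal_leI add_increasing)
      qed simp
    qed
    also have "\<dots> = (\<integral>\<^sup>+s. ennreal ((2/3) ^ \<gamma>) * (ennreal (kernel_ratio a s ^ \<gamma> * \<omega> s) * indicator {0..<1} s) \<partial>lborel)
        + (\<integral>\<^sup>+s. (ennreal (\<omega> s) * indicator {0..<1} s) * indicator {a..<1} s \<partial>lborel)"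
      by (rule nn_integral_add) measurable
    also have "(\<integral>\<^sup>+s. ennreal ((2/3) ^ \<gamma>) * (ennreal (kernel_ratio a s ^ \<gamma> * \<omega> s) * indicator {0..<1} s) \<partial>lborel) = ennreal ((2/3) ^ \<gamma>) * \<phi> a"
      unfolding \<phi>_def by (rule nn_integral_cmult) measurable
    also have "(\<integral>\<^sup>+s. (ennreal (\<omega> s) * indicator {0..<1} s) * indicator {a..<1} s \<partial>lborel) = (\<integral>\<^sup>+s\<in>{a..<1}. ennreal (\<omega> s) \<partial>lborel)"
      using a by (intro nn_integral_cong) (auto simp: indicator_def)
    also have "\<dots> = ennreal (omega_hat \<omega> a)" using a by (simp add: nn_integral_omega_hat[OF \<omega>])
    finally show ?thesis .
  qed
  \<comment> \<open>The induction runs over the dyadic distance to 1: \<open>b = 2 * a - 1\<close>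
    lies twice as far from 1 as \<open>a\<close>. The constant \<open>2 * C\<close> reproduces
    itself, since the contracted term and the tail each contribute at most
    \<open>omega_hat \<omega> b\<close>, which doubling bounds by
    \<open>C * omega_hat \<omega> a\<close>.\<close>
  have main: "\<phi> a \<le> ennreal (2 * C * omega_hat \<omega> a)" if "0 \<le> a" "a \<le> 1 - (1/2) ^ n" for a n
    using that
  proof (induction n arbitrary: a)
    case 0
    then have "a = 0" by simp
    have "\<phi> a \<le> ennreal (omega_hat \<omega> a)" using triv[of a] by (simp add: \<open>a = 0\<close>)
    also have "\<dots> \<le> ennreal (2 * C * omega_hat \<omega> a)"
      using C weight_facts(2)[of a] \<open>a = 0\<close> by (intro ennreal_leI) (simp add: mult_le_cancel_right1)
    finally show ?case .
  next
    case (Suc n)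
    have "(0::real) < (1/2) ^ Suc n" by simp
    then have a1: "a < 1" using Suc.prems by linarith
    show ?case
    \<comment> \<open>Below 1/2 the predecessor \<open>2 * a - 1\<close> would be negative; there
      the trivial bound by the full mass, with doubling at 0, is enough.\<close>
    proof (cases "a \<le> 1/2")
      case True
      have "omega_hat \<omega> 0 \<le> C * omega_hat \<omega> (1/2)" using C(2)[of 0] by simp
      also have "\<dots> \<le> C * omega_hat \<omega> a" using True Suc.prems C weight_facts(3)[of a "1/2"] by (intro mult_left_mono) auto
      also have "\<dots> \<le> 2 * C * omega_hat \<omega> a" using C weight_facts(2)[of a] a1 Suc.prems by simp
      finally show ?thesis using triv[of a] a1 Suc.prems by (meson ennreal_leI order_trans)
    next
      case False
      define b where "b = 2 * a - 1"
      have b: "0 \<le> b" "b < 1" "a = (1 + b) / 2" "b \<le> 1 - (1/2) ^ n" using False a1 Suc.prems by (auto simp: b_def)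
      have Wb: "0 < omega_hat \<omega> b" using weight_facts(2) b by blast
      have "\<phi> a \<le> ennreal ((2/3) ^ \<gamma>) * \<phi> b + ennreal (omega_hat \<omega> b)"
        using step[OF b(1,2)] unfolding b(3)[symmetric] .
      also have "\<dots> \<le> ennreal ((2/3) ^ \<gamma>) * ennreal (2 * C * omega_hat \<omega> b) + ennreal (omega_hat \<omega> b)"
        using Suc.IH[of b] b by (intro add_right_mono mult_left_mono) auto
      also have "\<dots> = ennreal ((2/3) ^ \<gamma> * (2 * C) * omega_hat \<omega> b + omega_hat \<omega> b)"
        using C Wb by (simp add: ennreal_mult[symmetric] ennreal_plus[symmetric] mult.assoc del: ennreal_plus ennreal_power)
      also have "\<dots> \<le> ennreal (2 * C * omega_hat \<omega> a)"
      proof (rule ennreal_leI)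
        have "(2/3) ^ \<gamma> * (2 * C) \<le> 1" using \<gamma> C by (simp add: pos_less_divide_eq)
        then have "(2/3) ^ \<gamma> * (2 * C) * omega_hat \<omega> b + omega_hat \<omega> b \<le> 1 * omega_hat \<omega> b + omega_hat \<omega> b"
          using Wb by (intro add_right_mono mult_right_mono) auto
        also have "\<dots> \<le> 2 * (C * omega_hat \<omega> a)" using C(2)[OF b(1,2)] unfolding b(3)[symmetric] by simp
        finally show "(2/3) ^ \<gamma> * (2 * C) * omega_hat \<omega> b + omega_hat \<omega> b \<le> 2 * C * omega_hat \<omega> a" by simp
      qed
      finally show ?thesis .
    qed
  qed
  show ?thesis
  proof (rule that[of \<gamma> "2 * C"])
    fix a :: real assume a: "0 \<le> a" "a < 1"
    then obtain n where "(1/2) ^ n < 1 - a" using real_arch_pow_inv[of "1 - a" "1/2"] by auto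
    then show "(\<integral>\<^sup>+s\<in>{0..<1}. ennreal (kernel_ratio a s ^ \<gamma> * \<omega> s) \<partial>lborel) \<le> ennreal (2 * C * omega_hat \<omega> a)"
      using main[of a n] a by (simp add: \<phi>_def)
  qed (use C \<gamma>1 in auto)
qed

section \<open>Comparison of moments with tails\<close>

lemma moment_nn_integral: "(\<integral>\<^sup>+s\<in>{0..<1}. ennreal (s ^ n * \<omega> s) \<partial>lborel) = ennreal (moment \<omega> n)"
  unfolding moment_def
  by (rule nn_integral_bounded_weight[OF \<omega>, where B=1]) (auto intro!: continuous_intros simp: power_le_one)

lemma moment_ge:
  assumes "0 \<le> r" "r < 1"
  shows "r ^ n * omega_hat \<omega> r \<le> moment \<omega> n"
proof -
  have "ennreal (r ^ n * omega_hat \<omega> r) = ennreal (r ^ n) * (\<integral>\<^sup>+s\<in>{r..<1}. ennreal (\<omega> s) \<partial>lborel)"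
    using assms weight_facts(2)[of r] by (simp add: nn_integral_omega_hat[OF \<omega>] ennreal_mult' del: ennreal_power)
  also have "\<dots> = (\<integral>\<^sup>+s. ennreal (r ^ n) * (ennreal (\<omega> s) * indicator {r..<1} s) \<partial>lborel)"
  proof (rule nn_integral_cmult[symmetric])
    note weight_measurable[OF \<omega>, measurable]
    have "(\<lambda>s. ennreal (\<omega> s) * indicator {r..<1} s) = (\<lambda>s. ennreal (indicator {0..<1} s * \<omega> s) * indicator {r..<1} s)"
      using assms by (auto simp: indicator_def)
    then show "(\<lambda>s. ennreal (\<omega> s) * indicator {r..<1} s) \<in> borel_measurable lborel" by simp
  qed
  also have "\<dots> \<le> (\<integral>\<^sup>+s\<in>{0..<1}. ennreal (s ^ n * \<omega> s) \<partial>lborel)"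
  proof (intro nn_integral_mono)
    fix s
    show "ennreal (r ^ n) * (ennreal (\<omega> s) * indicator {r..<1} s) \<le> ennreal (s ^ n * \<omega> s) * indicator {0..<1} s"
      using assms weight_facts(1)[of s]
      by (auto simp: indicator_def ennreal_mult[symmetric] simp del: ennreal_power intro!: ennreal_leI mult_right_mono power_mono)
  qed
  finally have "ennreal (r ^ n * omega_hat \<omega> r) \<le> ennreal (moment \<omega> n)" by (simp add: moment_nn_integral)
  moreover have "0 \<le> moment \<omega> n"
    unfolding moment_def set_lebesgue_integral_def using weight_facts(1) by (intro integral_nonneg_AE AE_I2) (auto simp: indicator_def)
  ultimately show ?thesis by (subst (asm) ennreal_le_iff) auto
qed

lemma moment_pos: "0 < moment \<omega> n"
  using moment_ge[of "1/2" n] weight_facts(2)[of "1/2"] by (intro less_le_trans[OF _ moment_ge[of "1/2" n]]) auto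

lemma moment_antimono:
  assumes "m \<le> n"
  shows "moment \<omega> n \<le> moment \<omega> m"
proof -
  have "ennreal (moment \<omega> n) \<le> ennreal (moment \<omega> m)"
    unfolding moment_nn_integral[symmetric]
  proof (intro nn_integral_mono)
    fix s
    show "ennreal (s ^ n * \<omega> s) * indicator {0..<1} s \<le> ennreal (s ^ m * \<omega> s) * indicator {0..<1} s"
      using assms weight_facts(1)[of s]
      by (auto simp: indicator_def intro!: ennreal_leI mult_right_mono power_decreasing)
  qed
  then show ?thesis using moment_pos[of m] by (subst (asm) ennreal_le_iff) auto
qed

text \<open>The mass of \<open>\<omega>\<close> below \<open>1 - 1 / n\<close> also contributes to
  the moment. \<open>power_le_kernel_ratio\<close> dominates the monomial by the kernel at this very
  point, and \<open>kernel_weight_bound\<close> absorbs that mass by doubling.\<close>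

lemma moment_le:
  assumes "D_hat \<omega>"
  obtains K :: real where "K > 0" "\<And>n. n \<ge> 1 \<Longrightarrow> moment \<omega> n \<le> K * omega_hat \<omega> (1 - 1 / real n)"
proof -
  obtain \<gamma> :: nat and K :: real where \<gamma>: "\<gamma> \<ge> 1" and K: "K > 0"
    and bound: "\<And>a. 0 \<le> a \<Longrightarrow> a < 1 \<Longrightarrow> (\<integral>\<^sup>+s\<in>{0..<1}. ennreal (kernel_ratio a s ^ \<gamma> * \<omega> s) \<partial>lborel) \<le> ennreal (K * omega_hat \<omega> a)"
    using kernel_weight_bound[OF assms] by blast
  show ?thesis
  proof (rule that[of "real \<gamma> ^ \<gamma> * K"])
    fix n :: nat assume n: "n \<ge> 1"
    let ?a = "1 - 1 / real n"
    have a: "0 \<le> ?a" "?a < 1" using n by auto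
    have "ennreal (moment \<omega> n) \<le> (\<integral>\<^sup>+s. ennreal (real \<gamma> ^ \<gamma>) * (ennreal (kernel_ratio ?a s ^ \<gamma> * \<omega> s) * indicator {0..<1} s) \<partial>lborel)"
      unfolding moment_nn_integral[symmetric]
    proof (intro nn_integral_mono)
      fix s
      show "ennreal (s ^ n * \<omega> s) * indicator {0..<1} s \<le> ennreal (real \<gamma> ^ \<gamma>) * (ennreal (kernel_ratio ?a s ^ \<gamma> * \<omega> s) * indicator {0..<1} s)"
      proof (cases "s \<in> {0..<1}")
        case True
        then have "s ^ n * \<omega> s \<le> real \<gamma> ^ \<gamma> * kernel_ratio ?a s ^ \<gamma> * \<omega> s"
          using power_le_kernel_ratio[OF n \<gamma>, of s] weight_facts(1)[of s] by (intro mult_right_mono) auto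
        then show ?thesis using True weight_facts(1)[of s] kernel_ratio_bounds[OF a, of s]
          by (auto simp: ennreal_mult[symmetric] mult.assoc simp del: ennreal_power intro!: ennreal_leI)
      qed simp
    qed
    also have "\<dots> = ennreal (real \<gamma> ^ \<gamma>) * (\<integral>\<^sup>+s\<in>{0..<1}. ennreal (kernel_ratio ?a s ^ \<gamma> * \<omega> s) \<partial>lborel)"
      using kernel_weight_measurable[OF a] by (intro nn_integral_cmult) simp
    also have "\<dots> \<le> ennreal (real \<gamma> ^ \<gamma>) * ennreal (K * omega_hat \<omega> ?a)"
      by (intro mult_left_mono bound a) auto
    also have "\<dots> = ennreal (real \<gamma> ^ \<gamma> * K * omega_hat \<omega> ?a)"
      using K weight_facts(2)[OF a] by (simp add: ennreal_mult[symmetric] mult.assoc del: ennreal_power)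
    finally show "moment \<omega> n \<le> real \<gamma> ^ \<gamma> * K * omega_hat \<omega> ?a"
      using K weight_facts(2)[OF a] by (subst (asm) ennreal_le_iff) auto
  qed (use K \<gamma> in auto)
qed

end

section \<open>Test functions\<close>

text \<open>There is no conjugate on \<open>\<alpha>\<close>, so the modulus peaks in the direction
  of \<open>cnj \<alpha>\<close>, and rotating the argument is the same as rotating the parameter.
  The numerator keeps the modulus at most 1 on the disc.\<close>

definition kernel_fun :: "nat \<Rightarrow> complex \<Rightarrow> complex \<Rightarrow> complex" where
  "kernel_fun \<gamma> \<alpha> z = (of_real (1 - cmod \<alpha>) / (1 - \<alpha> * z)) ^ \<gamma>"

lemma one_minus_mult_nz:
  fixes \<alpha> z :: complex
  assumes "cmod \<alpha> < 1" "cmod z < 1"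
  shows "1 - \<alpha> * z \<noteq> 0" "1 - cmod \<alpha> * cmod z \<le> cmod (1 - \<alpha> * z)"
proof -
  show le: "1 - cmod \<alpha> * cmod z \<le> cmod (1 - \<alpha> * z)"
    using norm_triangle_ineq2[of 1 "\<alpha> * z"] by (simp add: norm_mult)
  then show "1 - \<alpha> * z \<noteq> 0"
    using one_minus_mult_pos[of "cmod \<alpha>" "cmod z"] assms by auto
qed

lemma kernel_fun_has_field_derivative:
  assumes "cmod \<alpha> < 1" "cmod z < 1" "\<gamma> \<ge> 1"
  shows "(kernel_fun \<gamma> \<alpha> has_field_derivative
      of_nat \<gamma> * \<alpha> * of_real (1 - cmod \<alpha>) ^ \<gamma> / (1 - \<alpha> * z) ^ Suc \<gamma>) (at z)"
proof -
  obtain p where p: "\<gamma> = Suc p" using assms(3) by (cases \<gamma>) auto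
  let ?c = "of_real (1 - cmod \<alpha>) :: complex"
  have "((\<lambda>z. ?c / (1 - \<alpha> * z)) has_field_derivative ?c * \<alpha> / (1 - \<alpha> * z)\<^sup>2) (at z)"
    using one_minus_mult_nz[OF assms(1,2)]
    by (auto intro!: derivative_eq_intros simp: power2_eq_square)
  from DERIV_power[OF this, of \<gamma>] show ?thesis
    unfolding kernel_fun_def[abs_def] by (simp add: p power_divide power2_eq_square mult_ac)
qed

lemma holomorphic_kernel_fun:
  assumes "cmod \<alpha> < 1"
  shows "kernel_fun \<gamma> \<alpha> holomorphic_on ball 0 1"
  unfolding kernel_fun_def using one_minus_mult_nz[OF assms] by (intro holomorphic_intros) auto

text \<open>Of the \<gamma> + 1 powers in the denominator of the derivative, two are integrated
  exactly by \<open>poisson_has_integral\<close>, at the price of only one factor 1 / (1 - a r), and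
  the other \<gamma> - 1 are bounded pointwise. Bounding all of them pointwise would cost one power
  too many.\<close>

lemma circle_integral_kernel_fun:
  assumes \<alpha>: "cmod \<alpha> < 1" and \<gamma>: "\<gamma> \<ge> 1" and r: "0 \<le> r" "r < 1"
  shows "circle_integral (deriv (kernel_fun \<gamma> \<alpha>)) r \<le> 2 * pi * \<gamma> * kernel_ratio (cmod \<alpha>) r ^ \<gamma>"
proof -
  let ?a = "cmod \<alpha>"
  define \<beta> where "\<beta> = \<alpha> * of_real r"
  obtain p where p: "\<gamma> = Suc p" using \<gamma> by (cases \<gamma>) auto
  note ar = one_minus_mult_pos[of ?a r, OF _ \<alpha> r, OF norm_ge_zero]
  have \<beta>: "cmod \<beta> = ?a * r" using r by (simp add: \<beta>_def norm_mult)
  have hc: "continuous_on (ball 0 1) (deriv (kernel_fun \<gamma> \<alpha>))"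
    using \<alpha> by (intro holomorphic_on_imp_continuous_on holomorphic_deriv holomorphic_kernel_fun) auto
  have c: "0 \<le> \<gamma> * (1 - ?a) ^ \<gamma> / (1 - ?a * r) ^ p" using \<alpha> ar by (intro divide_nonneg_nonneg mult_nonneg_nonneg) auto
  have "circle_integral (deriv (kernel_fun \<gamma> \<alpha>)) r \<le> (\<gamma> * (1 - ?a) ^ \<gamma> / (1 - ?a * r) ^ p) * (2 * pi / (1 - (cmod \<beta>)\<^sup>2))"
  proof (rule has_integral_le[OF circle_has_integral[OF hc r]])
    show "((\<lambda>\<theta>. (\<gamma> * (1 - ?a) ^ \<gamma> / (1 - ?a * r) ^ p) * (1 / (norm (1 - \<beta> * cis \<theta>))\<^sup>2)) has_integral
        (\<gamma> * (1 - ?a) ^ \<gamma> / (1 - ?a * r) ^ p) * (2 * pi / (1 - (cmod \<beta>)\<^sup>2))) {0..2*pi}"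
      using ar by (intro has_integral_mult_right poisson_has_integral) (simp add: \<beta>)
    fix \<theta>
    let ?z = "of_real r * cis \<theta>"
    have z: "cmod ?z < 1" using r by (simp add: norm_mult)
    have \<alpha>z: "1 - \<alpha> * ?z = 1 - \<beta> * cis \<theta>" by (simp add: \<beta>_def)
    have le: "1 - ?a * r \<le> norm (1 - \<beta> * cis \<theta>)"
      using one_minus_mult_nz(2)[OF \<alpha> z] r unfolding \<alpha>z by (simp add: norm_mult)
    have "deriv (kernel_fun \<gamma> \<alpha>) ?z = of_nat \<gamma> * \<alpha> * of_real (1 - ?a) ^ \<gamma> / (1 - \<beta> * cis \<theta>) ^ Suc \<gamma>"
      using DERIV_imp_deriv[OF kernel_fun_has_field_derivative[OF \<alpha> z \<gamma>]] unfolding \<alpha>z .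
    then have "norm (deriv (kernel_fun \<gamma> \<alpha>) ?z) = \<gamma> * ?a * (1 - ?a) ^ \<gamma> / norm (1 - \<beta> * cis \<theta>) ^ Suc \<gamma>"
      using \<alpha> by (simp add: norm_mult norm_divide norm_power del: of_real_diff power_Suc)
    also have "\<dots> \<le> \<gamma> * 1 * (1 - ?a) ^ \<gamma> / ((1 - ?a * r) ^ p * (norm (1 - \<beta> * cis \<theta>))\<^sup>2)"
    proof (intro frac_le mult_right_mono mult_left_mono mult_nonneg_nonneg)
      have "(1 - ?a * r) ^ p * (norm (1 - \<beta> * cis \<theta>))\<^sup>2 \<le> norm (1 - \<beta> * cis \<theta>) ^ p * (norm (1 - \<beta> * cis \<theta>))\<^sup>2"
        using ar le by (intro mult_right_mono power_mono) auto
      then show "(1 - ?a * r) ^ p * (norm (1 - \<beta> * cis \<theta>))\<^sup>2 \<le> norm (1 - \<beta> * cis \<theta>) ^ Suc \<gamma>"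
        by (simp add: p power2_eq_square mult_ac)
      have "0 < norm (1 - \<beta> * cis \<theta>)" using le ar by linarith
      then show "0 < (1 - ?a * r) ^ p * (norm (1 - \<beta> * cis \<theta>))\<^sup>2" using ar by (intro mult_pos_pos zero_less_power) auto
    qed (use \<alpha> in \<open>auto simp: mult_left_le\<close>)
    finally show "norm (deriv (kernel_fun \<gamma> \<alpha>) ?z) \<le> (\<gamma> * (1 - ?a) ^ \<gamma> / (1 - ?a * r) ^ p) * (1 / (norm (1 - \<beta> * cis \<theta>))\<^sup>2)"
      by simp
  qed
  also have "\<dots> \<le> (\<gamma> * (1 - ?a) ^ \<gamma> / (1 - ?a * r) ^ p) * (2 * pi / (1 - ?a * r))"
  proof (intro mult_left_mono c frac_le)
    have "(cmod \<beta>)\<^sup>2 \<le> ?a * r" using ar r unfolding \<beta> power2_eq_square by (intro mult_left_le) auto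
    then show "1 - ?a * r \<le> 1 - (cmod \<beta>)\<^sup>2" by simp
  qed (use ar in auto)
  also have "\<dots> = 2 * pi * \<gamma> * kernel_ratio ?a r ^ \<gamma>"
    by (simp add: kernel_ratio_def power_divide p mult_ac)
  finally show ?thesis .
qed

lemma D1_norm_kernel_fun_le:
  assumes \<omega>: "radial_weight \<omega>" and "D_hat \<omega>"
  obtains \<gamma> :: nat and K :: real where "\<gamma> \<ge> 1" "K > 0"
    "\<And>\<alpha>. cmod \<alpha> < 1 \<Longrightarrow> D1_norm \<omega> (kernel_fun \<gamma> \<alpha>) \<le> ennreal (K * omega_hat \<omega> (cmod \<alpha>))"
proof -
  note weight = weight_nonneg[OF \<omega>] omega_hat_pos[OF \<omega>]
  obtain \<gamma> :: nat and K :: real where \<gamma>: "\<gamma> \<ge> 1" and K: "K > 0"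
    and bound: "\<And>a. 0 \<le> a \<Longrightarrow> a < 1 \<Longrightarrow> (\<integral>\<^sup>+s\<in>{0..<1}. ennreal (kernel_ratio a s ^ \<gamma> * \<omega> s) \<partial>lborel) \<le> ennreal (K * omega_hat \<omega> a)"
    using kernel_weight_bound[OF assms] by blast
  let ?W0 = "omega_hat \<omega> 0"
  have W0: "?W0 > 0" using weight(2)[of 0] by simp
  show ?thesis
  proof (rule that[of \<gamma> "2 * \<gamma> * K + K / ?W0"])
    fix \<alpha> :: complex assume \<alpha>: "cmod \<alpha> < 1"
    let ?a = "cmod \<alpha>" let ?f = "kernel_fun \<gamma> \<alpha>"
    note kb = kernel_ratio_bounds[of ?a, OF norm_ge_zero \<alpha>]
    define \<phi> where "\<phi> = (\<integral>\<^sup>+s\<in>{0..<1}. ennreal (kernel_ratio ?a s ^ \<gamma> * \<omega> s) \<partial>lborel)"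
    have \<phi>: "\<phi> \<le> ennreal (K * omega_hat \<omega> ?a)" unfolding \<phi>_def using bound \<alpha> by simp
    have Wa: "omega_hat \<omega> ?a > 0" using weight(2) \<alpha> by simp
    have "(\<integral>\<^sup>+r\<in>{0..<1}. ennreal (r * \<omega> r / pi * circle_integral (deriv ?f) r) \<partial>lborel)
        \<le> (\<integral>\<^sup>+s. ennreal (2 * \<gamma>) * (ennreal (kernel_ratio ?a s ^ \<gamma> * \<omega> s) * indicator {0..<1} s) \<partial>lborel)"
    proof (intro nn_integral_mono)
      fix r
      show "ennreal (r * \<omega> r / pi * circle_integral (deriv ?f) r) * indicator {0..<1} r
         \<le> ennreal (2 * \<gamma>) * (ennreal (kernel_ratio ?a r ^ \<gamma> * \<omega> r) * indicator {0..<1} r)"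
      proof (cases "r \<in> {0..<1}")
        case True
        then have r: "0 \<le> r" "r < 1" by auto
        have "r * \<omega> r / pi * circle_integral (deriv ?f) r \<le> 1 * \<omega> r / pi * (2 * pi * \<gamma> * kernel_ratio ?a r ^ \<gamma>)"
          using r weight(1)[OF r] circle_integral_nonneg
          by (intro mult_mono circle_integral_kernel_fun[OF \<alpha> \<gamma> r] divide_right_mono mult_right_mono) auto
        also have "\<dots> = 2 * \<gamma> * (kernel_ratio ?a r ^ \<gamma> * \<omega> r)" by simp
        finally show ?thesis using r weight(1)[OF r] kb[OF r]
          by (simp add: ennreal_mult[symmetric] ennreal_leI)
      qed simp
    qed
    also have "\<dots> = ennreal (2 * \<gamma>) * \<phi>"
      unfolding \<phi>_def using kernel_weight_measurable[OF \<omega>, of ?a \<gamma>] \<alpha> by (intro nn_integral_cmult) auto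
    also have "\<dots> \<le> ennreal (2 * \<gamma>) * ennreal (K * omega_hat \<omega> ?a)" by (intro mult_left_mono \<phi>) auto
    also have "\<dots> = ennreal (2 * \<gamma> * K * omega_hat \<omega> ?a)"
      using K Wa by (simp add: ennreal_mult[symmetric] mult.assoc)
    finally have 1: "(\<integral>\<^sup>+r\<in>{0..<1}. ennreal (r * \<omega> r / pi * circle_integral (deriv ?f) r) \<partial>lborel) \<le> ennreal (2 * \<gamma> * K * omega_hat \<omega> ?a)" .
    \<comment> \<open>The value at 0 has modulus \<open>(1 - ?a) ^ \<gamma>\<close>. Since the
      kernel ratio is at least \<open>1 - ?a\<close> throughout, the integral \<open>\<phi>\<close>
      bounds this term too; dividing by the full mass \<open>?W0\<close> gives the summand
      \<open>K / ?W0\<close> of the constant.\<close>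
    have "ennreal ((1 - ?a) ^ \<gamma> * ?W0) = ennreal ((1 - ?a) ^ \<gamma>) * (\<integral>\<^sup>+s\<in>{0..<1}. ennreal (\<omega> s) \<partial>lborel)"
      using \<alpha> W0 by (subst nn_integral_omega_hat[OF \<omega>]) (auto simp: ennreal_mult' simp del: ennreal_power)
    also have "\<dots> = (\<integral>\<^sup>+s. ennreal ((1 - ?a) ^ \<gamma>) * (ennreal (\<omega> s) * indicator {0..<1} s) \<partial>lborel)"
      using kernel_weight_measurable[OF \<omega>, of 0 0] by (intro nn_integral_cmult[symmetric]) simp
    also have "\<dots> \<le> \<phi>"
      unfolding \<phi>_def
    proof (intro nn_integral_mono)
      fix s
      show "ennreal ((1 - ?a) ^ \<gamma>) * (ennreal (\<omega> s) * indicator {0..<1} s) \<le> ennreal (kernel_ratio ?a s ^ \<gamma> * \<omega> s) * indicator {0..<1} s"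
        using \<alpha> kb[of s] weight(1)[of s]
        by (auto simp: indicator_def ennreal_mult[symmetric] simp del: ennreal_power intro!: ennreal_leI mult_right_mono power_mono)
    qed
    also note \<phi>
    finally have "(1 - ?a) ^ \<gamma> * ?W0 \<le> K * omega_hat \<omega> ?a"
      using K Wa by (subst (asm) ennreal_le_iff) auto
    then have "(1 - ?a) ^ \<gamma> \<le> K / ?W0 * omega_hat \<omega> ?a" using W0 by (simp add: pos_le_divide_eq)
    moreover have "norm (?f 0) = (1 - ?a) ^ \<gamma>" using \<alpha> by (simp add: kernel_fun_def norm_power del: of_real_diff)
    ultimately have 2: "ennreal (norm (?f 0)) \<le> ennreal (K / ?W0 * omega_hat \<omega> ?a)" by (simp add: ennreal_leI)
    have "D1_norm \<omega> ?f = (\<integral>\<^sup>+r\<in>{0..<1}. ennreal (r * \<omega> r / pi * circle_integral (deriv ?f) r) \<partial>lborel) + ennreal (norm (?f 0))"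
      by (intro D1_norm_polar holomorphic_kernel_fun weight_measurable \<omega> weight(1) \<alpha>)
    also have "\<dots> \<le> ennreal (2 * \<gamma> * K * omega_hat \<omega> ?a) + ennreal (K / ?W0 * omega_hat \<omega> ?a)"
      by (rule add_mono[OF 1 2])
    also have "\<dots> = ennreal ((2 * \<gamma> * K + K / ?W0) * omega_hat \<omega> ?a)"
      using K Wa W0 by (subst ennreal_plus[symmetric]) (auto simp: algebra_simps)
    finally show "D1_norm \<omega> ?f \<le> ennreal ((2 * \<gamma> * K + K / ?W0) * omega_hat \<omega> ?a)" .
  qed (use K W0 \<gamma> in \<open>auto intro: add_pos_pos\<close>)
qed

section \<open>Extracting a Taylor coefficient of the derivative of the symbol\<close>

lemma taylor_coeff_has_integral:
  fixes h :: "complex \<Rightarrow> complex"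
  assumes h: "h holomorphic_on ball 0 1" and \<rho>: "0 < \<rho>" "\<rho> < 1"
  shows "((\<lambda>t. h (of_real \<rho> * cis t) * cis (- (real m * t))) has_integral
      2 * pi * of_real \<rho> ^ m * ((deriv ^^ m) h 0 / fact m)) {0..2*pi}"
proof -
  have "((\<lambda>u. h u / (u - 0) ^ Suc m) has_contour_integral (2 * pi * \<i>) / fact m * (deriv ^^ m) h 0) (circlepath 0 \<rho>)"
    using \<rho> by (intro Cauchy_has_contour_integral_higher_derivative_circlepath
        holomorphic_on_imp_continuous_on holomorphic_on_subset[OF h]) auto
  then have "((\<lambda>t. h (0 + of_real \<rho> * cis t) / (0 + of_real \<rho> * cis t - 0) ^ Suc m * of_real \<rho> * \<i> * cis t)
      has_integral (2 * pi * \<i>) / fact m * (deriv ^^ m) h 0) {0..2*pi}"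
    unfolding circlepath_def by (subst (asm) has_contour_integral_part_circlepath_iff) auto
  \<comment> \<open>The factor removes the i from du = i u dt and the power \<rho>^m from 1 / u^m,
    leaving the pure frequency -m.\<close>
  from has_integral_mult_right[OF this, of "- \<i> * of_real \<rho> ^ m"]
  have "((\<lambda>t. - \<i> * of_real \<rho> ^ m * (h (0 + of_real \<rho> * cis t) / (0 + of_real \<rho> * cis t - 0) ^ Suc m * of_real \<rho> * \<i> * cis t))
      has_integral - \<i> * of_real \<rho> ^ m * ((2 * pi * \<i>) / fact m * (deriv ^^ m) h 0)) {0..2*pi}" .
  moreover have "- \<i> * of_real \<rho> ^ m * (h (0 + of_real \<rho> * cis t) / (0 + of_real \<rho> * cis t - 0) ^ Suc m * of_real \<rho> * \<i> * cis t)
     = h (of_real \<rho> * cis t) * cis (- (real m * t))" for t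
  proof -
    have "cis (- (real m * t)) = 1 / cis t ^ m"
      using cis_inverse[of "real m * t"] by (simp add: Complex.DeMoivre inverse_eq_divide)
    then show ?thesis using \<rho> by (simp add: field_simps power_mult_distrib)
  qed
  ultimately show ?thesis by (simp add: field_simps)
qed

lemma Tg_eq_integral:
  "Tg g f w = integral {0..1} (\<lambda>u. f (of_real u * w) * deriv g (of_real u * w) * w)"
  unfolding Tg_def contour_integral_integral
  by (intro integral_cong) (auto simp: vector_derivative_linepath_within scaleR_conv_of_real simp del: linepath_0
      intro!: arg_cong2[where f="(*)"] simp: linepath_def)

text \<open>On the radius towards \<open>a * cis t\<close> the rotated function takes the value of
  \<open>\<phi>\<close> at \<open>u * a\<close>, whatever t is. So integrating over t first replaces
  the derivative of g by its m-th Taylor term. The power \<open>a ^ Suc m\<close> combines (u a)^m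
  with the length a of the segment.\<close>

lemma rotated_Tg_coeff_bound:
  assumes g: "g holomorphic_on ball 0 1" and \<phi>: "\<phi> holomorphic_on ball 0 1" and a: "0 < a" "a < 1"
    and B: "\<And>t. norm (Tg g (\<lambda>z. \<phi> (cis (- t) * z)) (of_real a * cis t)) \<le> B"
  shows "norm ((deriv ^^ m) (deriv g) 0 / fact m)
     * norm (integral {0..1} (\<lambda>u. \<phi> (of_real (u * a)) * of_real (a ^ Suc m * u ^ m))) \<le> B"
proof -
  let ?b = "(deriv ^^ m) (deriv g) 0 / fact m"
  define H where "H t = Tg g (\<lambda>z. \<phi> (cis (- t) * z)) (of_real a * cis t)" for t
  have hol: "deriv g holomorphic_on ball 0 1" using g by (intro holomorphic_deriv) auto
  note dgc = holomorphic_on_imp_continuous_on[OF hol] and \<phi>c = holomorphic_on_imp_continuous_on[OF \<phi>]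
  have ua: "u * a < 1" if "0 \<le> u" "u \<le> 1" for u
    using that a by (intro le_less_trans[OF mult_left_le_one_le[of a u]]) auto
  define k where "k t u = \<phi> (of_real (u * a)) * deriv g (of_real (u * a) * cis t) * of_real a * cis (- (real m * t))" for t u :: real
  have kc: "continuous_on (cbox (0,0) (2*pi,1)) (\<lambda>(t,u). k t u)"
    unfolding k_def case_prod_unfold using a ua
    by (intro continuous_intros continuous_on_compose2[OF dgc] continuous_on_compose2[OF \<phi>c])
       (auto simp: norm_mult cbox_Pair_eq abs_mult simp del: of_real_mult)
  \<comment> \<open>The frequency is \<open>Suc m\<close> and not \<open>m\<close>, because the
    tangent of the radius contributes one factor \<open>cis t\<close>.\<close>
  have Hk: "H t * cis (- (real (Suc m) * t)) = integral {0..1} (k t)" for t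
  proof -
    have "H t * cis (- (real (Suc m) * t)) = integral {0..1} (\<lambda>u. \<phi> (cis (- t) * (of_real u * (of_real a * cis t))) * deriv g (of_real u * (of_real a * cis t)) * (of_real a * cis t) * cis (- (real (Suc m) * t)))"
      unfolding H_def Tg_eq_integral by (rule integral_mult_left[symmetric])
    also have "\<dots> = integral {0..1} (k t)"
    proof (rule integral_cong)
      fix u :: real
      have "cis t * cis (- (real (Suc m) * t)) = cis (- (real m * t))" by (simp add: cis_mult algebra_simps)
      moreover have "cis (- t) * (of_real u * (of_real a * cis t)) = of_real (u * a)"
        by (simp add: algebra_simps cis_mult)
      ultimately show "\<phi> (cis (- t) * (of_real u * (of_real a * cis t))) * deriv g (of_real u * (of_real a * cis t)) * (of_real a * cis t) * cis (- (real (Suc m) * t)) = k t u"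
        by (simp only: k_def mult.assoc of_real_mult)
    qed
    finally show ?thesis .
  qed
  have "integral {0..2*pi} (\<lambda>t. integral {0..1} (k t)) = integral {0..1} (\<lambda>u. integral {0..2*pi} (\<lambda>t. k t u))"
    using integral_swap_continuous[of 0 0 "2*pi" 1 k] kc by simp
  also have "\<dots> = integral {0..1} (\<lambda>u. 2 * pi * ?b * (\<phi> (of_real (u * a)) * of_real (a ^ Suc m * u ^ m)))"
  \<comment> \<open>At u = 0 the circle degenerates and \<open>taylor_coeff_has_integral\<close>
    does not apply; this is a null set.\<close>
  proof (rule integral_spike[of "{0}"])
    fix u :: real assume "u \<in> {0..1} - {0}"
    then have u: "0 < u" "u \<le> 1" by auto
    have "((\<lambda>t. \<phi> (of_real (u * a)) * of_real a * (deriv g (of_real (u * a) * cis t) * cis (- (real m * t)))) has_integral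
       \<phi> (of_real (u * a)) * of_real a * (2 * pi * of_real (u * a) ^ m * ?b)) {0..2*pi}"
      using u a ua by (intro has_integral_mult_right taylor_coeff_has_integral hol) auto
    then have "integral {0..2*pi} (\<lambda>t. k t u) = \<phi> (of_real (u * a)) * of_real a * (2 * pi * of_real (u * a) ^ m * ?b)"
      by (intro integral_unique) (simp add: k_def mult_ac)
    then show "2 * pi * ?b * (\<phi> (of_real (u * a)) * of_real (a ^ Suc m * u ^ m)) = integral {0..2*pi} (\<lambda>t. k t u)"
      by (simp add: power_mult_distrib mult_ac)
  qed simp
  also have "\<dots> = 2 * pi * ?b * integral {0..1} (\<lambda>u. \<phi> (of_real (u * a)) * of_real (a ^ Suc m * u ^ m))"
    by (rule integral_mult_right)
  finally have eq: "integral {0..2*pi} (\<lambda>t. integral {0..1} (k t)) = 2 * pi * ?b * integral {0..1} (\<lambda>u. \<phi> (of_real (u * a)) * of_real (a ^ Suc m * u ^ m))" .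
  have "norm (integral {0..2*pi} (\<lambda>t. integral {0..1} (k t))) \<le> integral {0..2*pi} (\<lambda>t. B)"
  proof (rule integral_norm_bound_integral)
    have "continuous_on (cbox 0 (2*pi)) (\<lambda>t. integral (cbox 0 1) (k t))"
      using kc by (intro integral_continuous_on_param) (simp add: cbox_Pair_eq)
    then show "(\<lambda>t. integral {0..1} (k t)) integrable_on {0..2*pi}"
      by (intro integrable_continuous_real) simp
    show "norm (integral {0..1} (k t)) \<le> B" for t
      using B[of t] unfolding Hk[symmetric] H_def by (simp add: norm_mult)
  qed auto
  then have "(2 * pi) * (norm ?b * norm (integral {0..1} (\<lambda>u. \<phi> (of_real (u * a)) * of_real (a ^ Suc m * u ^ m)))) \<le> (2 * pi) * B"
    unfolding eq norm_mult by (simp add: mult.assoc)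
  then show ?thesis by (rule mult_left_le_imp_le) simp
qed

text \<open>The integrand is nonnegative, so the stretch \<open>{a..1}\<close> of length
  \<open>1 - a\<close> suffices. There 1 - a (u a) <= 1 - a^3 <= 3 (1 - a), which gives the 1/3, and
  both a and u are at least 1/2, which gives the exponent 2 m + 1.\<close>

lemma kernel_fun_integral_ge:
  assumes a: "1/2 \<le> a" "a < 1"
  shows "(1 - a) * ((1/3) ^ \<gamma> * (1/2) ^ (2 * m + 1))
    \<le> norm (integral {0..1} (\<lambda>u. kernel_fun \<gamma> (of_real a) (of_real (u * a)) * of_real (a ^ Suc m * u ^ m)))"
proof -
  define q where "q u = kernel_ratio a (u * a) ^ \<gamma> * (a ^ Suc m * u ^ m)" for u
  have ua: "u * a < 1" if "0 \<le> u" "u \<le> 1" for u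
    using that a by (intro le_less_trans[OF mult_left_le_one_le[of a u]]) auto
  have q0: "0 \<le> q u" if "0 \<le> u" "u \<le> 1" for u
    using kernel_ratio_bounds(1)[of a "u * a"] ua[OF that] a that by (simp add: q_def)
  have "kernel_fun \<gamma> (of_real a) (of_real (u * a)) * of_real (a ^ Suc m * u ^ m) = of_real (q u)" for u
    using a by (simp add: kernel_fun_def q_def kernel_ratio_def)
  moreover have qc: "continuous_on {0..1} q"
    unfolding q_def using a ua
    by (intro continuous_intros continuous_on_compose2[OF continuous_on_kernel_ratio[of a \<gamma>]]) auto
  then have qi: "q integrable_on S" if "S = {x..y}" "0 \<le> x" "y \<le> 1" for S x y
    unfolding that(1) using that(2,3) by (intro integrable_continuous_real continuous_on_subset[OF qc]) auto
  have "((\<lambda>u. complex_of_real (q u)) has_integral of_real (integral {0..1} q)) {0..1}"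
    using has_integral_of_real[OF integrable_integral[OF qi]] by auto
  ultimately have "integral {0..1} (\<lambda>u. kernel_fun \<gamma> (of_real a) (of_real (u * a)) * of_real (a ^ Suc m * u ^ m)) = complex_of_real (integral {0..1} q)"
    by (auto intro: integral_unique)
  then have n: "norm (integral {0..1} (\<lambda>u. kernel_fun \<gamma> (of_real a) (of_real (u * a)) * of_real (a ^ Suc m * u ^ m))) = \<bar>integral {0..1} q\<bar>"
    by simp
  have "(1 - a) * ((1/3) ^ \<gamma> * (1/2) ^ (2 * m + 1)) = integral {a..1} (\<lambda>u. (1/3) ^ \<gamma> * (1/2) ^ (2 * m + 1))"
    using a by simp
  also have "\<dots> \<le> integral {a..1} q"
  proof (rule integral_le)
    fix u assume u: "u \<in> {a..1}"
    have "a * (u * a) \<ge> a * (a * a)" using u a by (intro mult_left_mono mult_right_mono) auto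
    moreover have "1 - a * (a * a) = (1 - a) * (1 + a + a * a)" by (simp add: algebra_simps)
    moreover have "(1 - a) * (1 + a + a * a) \<le> (1 - a) * 3"
      using a mult_mono[of a 1 a 1] by (intro mult_left_mono) auto
    ultimately have "1 - a * (u * a) \<le> 3 * (1 - a)" by simp
    moreover have "0 < 1 - a * (u * a)" using one_minus_mult_pos[of a "u * a"] ua[of u] u a by auto
    ultimately have "1/3 \<le> kernel_ratio a (u * a)" by (simp add: kernel_ratio_def pos_le_divide_eq)
    moreover have "(1/2) ^ (2 * m + 1) \<le> a ^ Suc m * u ^ m"
    proof -
      have "(1/2 :: real) ^ (2 * m + 1) = (1/2) ^ Suc m * (1/2) ^ m" by (simp add: mult_2 power_add)
      also have "\<dots> \<le> a ^ Suc m * u ^ m" using a u by (intro mult_mono power_mono) auto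
      finally show ?thesis .
    qed
    ultimately show "(1/3) ^ \<gamma> * (1/2) ^ (2 * m + 1) \<le> q u"
      unfolding q_def by (intro mult_mono power_mono) auto
  qed (use a in \<open>auto intro: qi[OF refl]\<close>)
  also have "\<dots> \<le> integral {0..1} q"
    using a q0 by (intro integral_subset_le qi[OF refl]) auto
  finally show ?thesis unfolding n by linarith
qed

lemma T_Hinf_nonconstant_imp_bounded:
  assumes \<omega>: "radial_weight \<omega>" and D: "D_hat \<omega>"
    and g: "g \<in> T_Hinf \<omega>" and nonconst: "\<nexists>c. \<forall>z\<in>ball 0 1. g z = c"
  shows "\<exists>C. \<forall>r\<in>{0..<1}. (1 - r) / omega_hat \<omega> r \<le> C"
proof -
  note weight = omega_hat_pos[OF \<omega>] omega_hat_antimono[OF \<omega>]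
  obtain C where holg: "g holomorphic_on ball 0 1"
    and C: "\<And>f z. f \<in> D1 \<omega> \<Longrightarrow> z \<in> ball 0 1 \<Longrightarrow> ennreal (norm (Tg g f z)) \<le> ennreal C * D1_norm \<omega> f"
    using g unfolding T_Hinf_def by blast
  have hol: "deriv g holomorphic_on ball 0 1" using holg by (intro holomorphic_deriv) auto
  obtain m where m: "(deriv ^^ m) (deriv g) 0 \<noteq> 0"
  proof (rule ccontr)
    assume "\<not> thesis"
    then have z: "(deriv ^^ m) (deriv g) 0 = 0" for m using that by blast
    have "deriv g w = 0" if "w \<in> ball 0 1" for w
      using holomorphic_fun_eq_0_on_ball[OF hol that] z by simp
    then have "(g has_field_derivative 0) (at w within ball 0 1)" if "w \<in> ball 0 1" for w
      using holomorphic_derivI[OF holg open_ball that] that by simp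
    then have "\<exists>c. \<forall>w\<in>ball 0 1. g w = c"
      using has_field_derivative_zero_constant[of "ball 0 1" g] by auto
    with nonconst show False by blast
  qed
  obtain \<gamma> :: nat and K :: real where \<gamma>: "\<gamma> \<ge> 1" and K: "K > 0"
    and bound: "\<And>\<alpha>. cmod \<alpha> < 1 \<Longrightarrow> D1_norm \<omega> (kernel_fun \<gamma> \<alpha>) \<le> ennreal (K * omega_hat \<omega> (cmod \<alpha>))"
    using D1_norm_kernel_fun_le[OF \<omega> D] by blast
  let ?b = "norm ((deriv ^^ m) (deriv g) 0 / fact m)"
  define d where "d = ?b * ((1/3) ^ \<gamma> * (1/2) ^ (2 * m + 1))"
  have d: "d > 0" using m by (simp add: d_def)
  \<comment> \<open>The constant in \<open>T_Hinf\<close> may be negative, in which case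
    \<open>ennreal C\<close> is 0; the maximum allows the return to real inequalities.\<close>
  define C' where "C' = max C 0"
  have large: "(1 - a) / omega_hat \<omega> a \<le> C' * K / d" if a: "1/2 \<le> a" "a < 1" for a
  proof -
    have Wa: "omega_hat \<omega> a > 0" using weight(1)[of a] a by simp
    have "?b * norm (integral {0..1} (\<lambda>u. kernel_fun \<gamma> (of_real a) (of_real (u * a)) * of_real (a ^ Suc m * u ^ m))) \<le> C' * (K * omega_hat \<omega> a)"
    proof (rule rotated_Tg_coeff_bound[OF holg])
      show "kernel_fun \<gamma> (of_real a) holomorphic_on ball 0 1" using a by (intro holomorphic_kernel_fun) simp
      fix t
      define \<alpha> where "\<alpha> = of_real a * cis (- t)"
      have \<alpha>: "cmod \<alpha> = a" using a by (simp add: \<alpha>_def norm_mult)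
      have rot: "(\<lambda>z. kernel_fun \<gamma> (of_real a) (cis (- t) * z)) = kernel_fun \<gamma> \<alpha>"
        using a \<alpha> by (simp add: kernel_fun_def \<alpha>_def mult.assoc fun_eq_iff norm_mult)
      have N: "D1_norm \<omega> (kernel_fun \<gamma> \<alpha>) \<le> ennreal (K * omega_hat \<omega> a)" using bound[of \<alpha>] \<alpha> a by simp
      then have "kernel_fun \<gamma> \<alpha> \<in> D1 \<omega>"
        using holomorphic_kernel_fun[of \<alpha> \<gamma>] \<alpha> a by (auto simp: D1_def intro: le_less_trans)
      then have "ennreal (norm (Tg g (kernel_fun \<gamma> \<alpha>) (of_real a * cis t))) \<le> ennreal C * D1_norm \<omega> (kernel_fun \<gamma> \<alpha>)"
        using a by (intro C) (auto simp: norm_mult)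
      also have "\<dots> \<le> ennreal C' * ennreal (K * omega_hat \<omega> a)"
        by (intro mult_mono N ennreal_leI) (auto simp: C'_def)
      also have "\<dots> = ennreal (C' * (K * omega_hat \<omega> a))"
        using K Wa by (intro ennreal_mult[symmetric]) (auto simp: C'_def)
      finally show "norm (Tg g (\<lambda>z. kernel_fun \<gamma> (of_real a) (cis (- t) * z)) (of_real a * cis t)) \<le> C' * (K * omega_hat \<omega> a)"
        unfolding rot using K Wa by (subst (asm) ennreal_le_iff) (auto simp: C'_def)
    qed (use a in auto)
    moreover have "d * (1 - a) \<le> ?b * norm (integral {0..1} (\<lambda>u. kernel_fun \<gamma> (of_real a) (of_real (u * a)) * of_real (a ^ Suc m * u ^ m)))"
      using mult_left_mono[OF kernel_fun_integral_ge[OF a, of \<gamma> m] norm_ge_zero[of "(deriv ^^ m) (deriv g) 0 / fact m"]]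
      by (simp add: d_def mult_ac)
    ultimately have "d * (1 - a) \<le> C' * (K * omega_hat \<omega> a)" by linarith
    then show ?thesis using d Wa by (simp add: divide_simps mult_ac)
  qed
  \<comment> \<open>The lower bound for the kernel integral starts at 1/2; for smaller radii the
    monotonicity of the tail is enough.\<close>
  have small: "(1 - a) / omega_hat \<omega> a \<le> 1 / omega_hat \<omega> (1/2)" if "0 \<le> a" "a \<le> 1/2" for a
    using that weight(1)[of "1/2"] weight(2)[of a "1/2"] by (intro frac_le) auto
  show ?thesis
  proof (intro exI ballI)
    fix r :: real assume "r \<in> {0..<1}"
    then show "(1 - r) / omega_hat \<omega> r \<le> max (C' * K / d) (1 / omega_hat \<omega> (1/2))"
      using large[of r] small[of r] by (cases "r \<le> 1/2") (auto simp: le_max_iff_disj)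
  qed
qed

section \<open>Equivalence of the four conditions\<close>

text \<open>Conditions (ii) and (iii) enter the implications as the absence of a real bound. A
  negative C does no harm, as \<open>ennreal C\<close> is then 0.\<close>

lemma SUP_ennreal_eq_top_iff:
  fixes G :: "'a \<Rightarrow> ennreal"
  shows "(SUP r\<in>A. G r) = \<infinity> \<longleftrightarrow> \<not> (\<exists>C::real. \<forall>r\<in>A. G r \<le> ennreal C)"
proof
  assume top: "(SUP r\<in>A. G r) = \<infinity>"
  show "\<not> (\<exists>C::real. \<forall>r\<in>A. G r \<le> ennreal C)"
  proof
    assume "\<exists>C::real. \<forall>r\<in>A. G r \<le> ennreal C"
    then obtain C :: real where "(SUP r\<in>A. G r) \<le> ennreal C" by (auto intro: SUP_least)
    then show False unfolding top by (simp add: top_unique)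
  qed
next
  assume unbounded: "\<not> (\<exists>C::real. \<forall>r\<in>A. G r \<le> ennreal C)"
  show "(SUP r\<in>A. G r) = \<infinity>"
  proof (rule ccontr)
    assume "(SUP r\<in>A. G r) \<noteq> \<infinity>"
    then obtain C where "(SUP r\<in>A. G r) = ennreal C" by (cases "SUP r\<in>A. G r") auto
    then have "\<forall>r\<in>A. G r \<le> ennreal C" by (metis SUP_upper)
    with unbounded show False by blast
  qed
qed

lemma omega_hat_bound_imp_moment_sum_bound:
  assumes \<omega>: "radial_weight \<omega>"
    and C: "\<And>r. 0 \<le> r \<Longrightarrow> r < 1 \<Longrightarrow> 1 - r \<le> C * omega_hat \<omega> r" and C0: "C > 0" and r: "0 \<le> r" "r < 1"
  shows "ennreal (1 - r) * (\<Sum>k. ennreal (r ^ Suc k / ((real (Suc k) + 1) * moment \<omega> (Suc k)))) \<le> ennreal (4 * C)"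
proof -
  have term_le: "r ^ n / ((real n + 1) * moment \<omega> n) \<le> 4 * C * r ^ n" if n: "n \<ge> 1" for n
  proof -
    \<comment> \<open>Bernoulli's inequality at this point gives \<open>?s ^ n \<ge> 1/2\<close>,
      while \<open>1 - ?s\<close> is still of order 1/n. So \<open>moment_ge\<close> yields a lower
      bound for n times the moment, and each term of the series is at most
      \<open>4 * C * r ^ n\<close>.\<close>
    let ?s = "1 - 1 / (2 * real n)"
    have s: "0 \<le> ?s" "?s < 1" using n by (auto simp: field_simps)
    have "1/2 \<le> ?s ^ n"
      using Bernoulli_inequality[of "- (1 / (2 * real n))" n] n by (simp add: field_simps)
    then have "1/2 * omega_hat \<omega> ?s \<le> ?s ^ n * omega_hat \<omega> ?s"
      using omega_hat_pos[OF \<omega> s] by (intro mult_right_mono) auto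
    also have "\<dots> \<le> moment \<omega> n" by (rule moment_ge[OF \<omega> s])
    finally have "C * omega_hat \<omega> ?s \<le> 2 * C * moment \<omega> n" using C0 by simp
    with C[OF s] have "1 / (2 * real n) \<le> 2 * C * moment \<omega> n" by linarith
    then have "1 \<le> 4 * C * (real n * moment \<omega> n)" using n by (simp add: field_simps)
    also have "\<dots> \<le> 4 * C * ((real n + 1) * moment \<omega> n)"
      using C0 moment_pos[OF \<omega>, of n] by (intro mult_left_mono mult_right_mono) auto
    finally have "r ^ n * 1 \<le> r ^ n * (4 * C * ((real n + 1) * moment \<omega> n))" using r by (intro mult_left_mono) auto
    moreover have "0 < (real n + 1) * moment \<omega> n" using moment_pos[OF \<omega>, of n] by simp
    ultimately show ?thesis by (simp add: pos_divide_le_eq mult_ac)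
  qed
  have sums: "(\<lambda>k. 4 * C * r * r ^ k) sums (4 * C * r * (1 / (1 - r)))"
    using r by (intro sums_mult geometric_sums) auto
  have "(\<Sum>k. ennreal (r ^ Suc k / ((real (Suc k) + 1) * moment \<omega> (Suc k)))) \<le> (\<Sum>k. ennreal (4 * C * r * r ^ k))"
    using term_le[of "Suc _"] by (intro suminf_le ennreal_leI) (auto simp: mult_ac)
  also have "\<dots> = ennreal (4 * C * r * (1 / (1 - r)))"
    using sums C0 r by (subst suminf_ennreal2) (auto simp: sums_iff)
  finally have "ennreal (1 - r) * (\<Sum>k. ennreal (r ^ Suc k / ((real (Suc k) + 1) * moment \<omega> (Suc k)))) \<le> ennreal (1 - r) * ennreal (4 * C * r * (1 / (1 - r)))"
    by (rule mult_left_mono) simp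
  also have "\<dots> = ennreal (4 * C * r)" using r C0 by (simp add: ennreal_mult[symmetric])
  also have "\<dots> \<le> ennreal (4 * C)" using r C0 by (intro ennreal_leI) (simp add: mult_left_le)
  finally show ?thesis .
qed

text \<open>At a radius at distance 1 / (4 n) from 1, a block of n terms already forces n times the
  n-th moment to stay away from 0. \<open>moment_le\<close> transfers this to the tails, where
  doubling enters.\<close>

lemma moment_sum_bound_imp_omega_hat_bound:
  assumes \<omega>: "radial_weight \<omega>" and D: "D_hat \<omega>"
    and C: "\<And>r. 0 \<le> r \<Longrightarrow> r < 1 \<Longrightarrow>
      ennreal (1 - r) * (\<Sum>k. ennreal (r ^ Suc k / ((real (Suc k) + 1) * moment \<omega> (Suc k)))) \<le> ennreal C"
  shows "\<exists>C. \<forall>r\<in>{0..<1}. (1 - r) / omega_hat \<omega> r \<le> C"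
proof -
  define C' where "C' = max C 0"
  obtain K where K: "K > 0" "\<And>n. n \<ge> 1 \<Longrightarrow> moment \<omega> n \<le> K * omega_hat \<omega> (1 - 1 / real n)"
    using moment_le[OF \<omega> D] by blast
  have moment_lower: "1 \<le> 16 * C' * (real n * moment \<omega> n)" if n: "n \<ge> 1" for n
  proof -
    \<comment> \<open>The factor 4 keeps even the power \<open>2 * n\<close> above 1/2, so no term
      of the block below decays.\<close>
    let ?r = "1 - 1 / (4 * real n)"
    let ?t = "\<lambda>k. ?r ^ Suc k / ((real (Suc k) + 1) * moment \<omega> (Suc k))"
    have r: "0 \<le> ?r" "?r < 1" using n by (auto simp: field_simps)
    have mp: "moment \<omega> k > 0" for k by (rule moment_pos[OF \<omega>])
    have half: "1/2 \<le> ?r ^ (2 * n)"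
      using Bernoulli_inequality[of "- (1 / (4 * real n))" "2 * n"] n by (simp add: field_simps)
    \<comment> \<open>The exponents \<open>Suc k\<close> run through n, ..., 2 n - 1, so there are n
      terms, \<open>real (Suc k) + 1\<close> is at most 2 n, and each moment is at most the n-th
      one.\<close>
    have t: "(1/2) / (2 * real n * moment \<omega> n) \<le> ?t k" if "k \<in> {n - 1..<2 * n - 1}" for k
    proof (rule frac_le)
      have k: "n \<le> Suc k" "Suc k \<le> 2 * n" "Suc k + 1 \<le> 2 * n" using that n by auto
      show "1/2 \<le> ?r ^ Suc k"
        using half power_decreasing[OF k(2) r(1)] r(2) by linarith
      show "0 < (real (Suc k) + 1) * moment \<omega> (Suc k)" using mp by simp
      have "real (Suc k) + 1 \<le> 2 * real n" using k(3) by linarith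
      then show "(real (Suc k) + 1) * moment \<omega> (Suc k) \<le> 2 * real n * moment \<omega> n"
        using mp[of "Suc k"] moment_antimono[OF \<omega> k(1)] by (intro mult_mono) auto
    qed (rule zero_le_power[OF r(1)])
    have t0: "0 \<le> ?t k" for k
      by (rule divide_nonneg_pos[OF zero_le_power[OF r(1)] mult_pos_pos[OF _ mp]]) simp
    have "1 / (4 * moment \<omega> n) = (\<Sum>k\<in>{n - 1..<2 * n - 1}. (1/2) / (2 * real n * moment \<omega> n))"
      using n by (simp add: field_simps)
    also have "\<dots> \<le> (\<Sum>k\<in>{n - 1..<2 * n - 1}. ?t k)" by (rule sum_mono[OF t])
    finally have "ennreal (1 / (4 * moment \<omega> n)) \<le> (\<Sum>k\<in>{n - 1..<2 * n - 1}. ennreal (?t k))"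
      using t0 by (subst sum_ennreal) (auto intro: ennreal_leI)
    also have "\<dots> \<le> (\<Sum>k. ennreal (?t k))" by (rule sum_le_suminf) auto
    finally have "ennreal (1 - ?r) * ennreal (1 / (4 * moment \<omega> n)) \<le> ennreal (1 - ?r) * (\<Sum>k. ennreal (?t k))"
      by (rule mult_left_mono) simp
    also have "\<dots> \<le> ennreal C" by (rule C[OF r])
    also have "\<dots> \<le> ennreal C'" by (rule ennreal_leI) (simp add: C'_def)
    finally have "(1 - ?r) * (1 / (4 * moment \<omega> n)) \<le> C'"
      using r mp[of n] by (subst (asm) ennreal_mult[symmetric]) (auto simp: C'_def)
    then show ?thesis using n mp[of n] by (simp add: field_simps)
  qed
  show ?thesis
  proof (intro exI ballI)
    fix r :: real assume "r \<in> {0..<1}"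
    then have r: "0 \<le> r" "r < 1" by auto
    \<comment> \<open>The least n with \<open>r \<le> 1 - 1 / n\<close>. It is at most
      \<open>2 / (1 - r)\<close>, so passing from r to n costs only a factor 2.\<close>
    define n where "n = nat \<lceil>1 / (1 - r)\<rceil>"
    have inv: "1 \<le> 1 / (1 - r)" using r by simp
    then have n1: "1 / (1 - r) \<le> real n" "real n \<le> 1 / (1 - r) + 1" unfolding n_def by linarith+
    then have n: "n \<ge> 1" using inv by linarith
    have rn: "r \<le> 1 - 1 / real n" using n1(1) n r by (simp add: field_simps)
    have W: "omega_hat \<omega> (1 - 1 / real n) \<le> omega_hat \<omega> r"
      using omega_hat_antimono[OF \<omega> r(1) rn] n by simp
    have C'0: "0 \<le> C'" by (simp add: C'_def)
    have "1 \<le> 16 * C' * (real n * moment \<omega> n)" by (rule moment_lower[OF n])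
    also have "\<dots> \<le> 16 * C' * (2 / (1 - r) * (K * omega_hat \<omega> r))"
    proof (intro mult_left_mono mult_mono)
      show "real n \<le> 2 / (1 - r)" using n1(2) inv by (simp add: field_simps)
      show "moment \<omega> n \<le> K * omega_hat \<omega> r"
        using K(2)[OF n] mult_left_mono[OF W, of K] K(1) by linarith
      show "0 \<le> moment \<omega> n" using moment_pos[OF \<omega>, of n] by simp
    qed (use C'0 r in auto)
    finally have "1 - r \<le> 32 * C' * K * omega_hat \<omega> r" using r by (simp add: field_simps)
    then show "(1 - r) / omega_hat \<omega> r \<le> 32 * C' * K"
      using omega_hat_pos[OF \<omega> r] by (simp add: pos_divide_le_eq)
  qed
qed

theorem mainTheorem3:
  fixes \<omega> :: "real \<Rightarrow> real"
  assumes "radial_weight \<omega>" and "D_hat \<omega>"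
  shows "((T_Hinf \<omega> \<subseteq> {g. \<exists>c. \<forall>z\<in>ball 0 1. g z = c})
          \<longleftrightarrow> (SUP r\<in>{0..<1}. ennreal ((1 - r) / omega_hat \<omega> r)) = \<infinity>)
       \<and> ((SUP r\<in>{0..<1}. ennreal ((1 - r) / omega_hat \<omega> r)) = \<infinity>
          \<longleftrightarrow> (SUP r\<in>{0..<1}. ennreal (1 - r) *
                 (\<Sum>k. ennreal (r ^ (Suc k) / ((real (Suc k) + 1) * moment \<omega> (Suc k))))) = \<infinity>)
       \<and> ((SUP r\<in>{0..<1}. ennreal (1 - r) *
                 (\<Sum>k. ennreal (r ^ (Suc k) / ((real (Suc k) + 1) * moment \<omega> (Suc k))))) = \<infinity>
          \<longleftrightarrow> \<not> (\<exists>C::real. \<forall>f\<in>D1 \<omega>. D1_norm (\<lambda>_. 1) f \<le> ennreal C * D1_norm \<omega> f))"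
proof -
  define S3 where "S3 r = ennreal (1 - r) * (\<Sum>k. ennreal (r ^ (Suc k) / ((real (Suc k) + 1) * moment \<omega> (Suc k))))" for r
  let ?const = "T_Hinf \<omega> \<subseteq> {g. \<exists>c. \<forall>z\<in>ball 0 1. g z = c}"
  \<comment> \<open>This bound is the hub: it is equivalent to \<open>?B3\<close>, and the
    implications from \<open>?B2\<close> to \<open>?B4\<close>, from there to the existence of a
    nonconstant symbol, and back to \<open>?B2\<close> close a cycle.\<close>
  let ?B2 = "\<exists>C. \<forall>r\<in>{0..<1}. (1 - r) / omega_hat \<omega> r \<le> C"
  let ?B3 = "\<exists>C::real. \<forall>r\<in>{0..<1}. S3 r \<le> ennreal C"
  let ?B4 = "\<exists>C::real. \<forall>f\<in>D1 \<omega>. D1_norm (\<lambda>_. 1) f \<le> ennreal C * D1_norm \<omega> f"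
  have ii: "(SUP r\<in>{0..<1}. ennreal ((1 - r) / omega_hat \<omega> r)) = \<infinity> \<longleftrightarrow> \<not> ?B2"
  proof -
    have "(\<exists>C::real. \<forall>r\<in>{0..<1}. ennreal ((1 - r) / omega_hat \<omega> r) \<le> ennreal C) \<longleftrightarrow> ?B2"
    proof
      assume "\<exists>C::real. \<forall>r\<in>{0..<1}. ennreal ((1 - r) / omega_hat \<omega> r) \<le> ennreal C"
      then obtain C :: real where C: "\<forall>r\<in>{0..<1}. ennreal ((1 - r) / omega_hat \<omega> r) \<le> ennreal C" by blast
      have "(1 - r) / omega_hat \<omega> r \<le> max C 0" if "r \<in> {0..<1}" for r
      proof -
        have "ennreal ((1 - r) / omega_hat \<omega> r) \<le> ennreal (max C 0)"
          by (rule order_trans[OF C[rule_format, OF that] ennreal_leI]) simp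
        then show ?thesis by (subst (asm) ennreal_le_iff) auto
      qed
      then show ?B2 by blast
    next
      assume ?B2
      then show "\<exists>C::real. \<forall>r\<in>{0..<1}. ennreal ((1 - r) / omega_hat \<omega> r) \<le> ennreal C"
        by (meson ennreal_leI)
    qed
    then show ?thesis by (simp only: SUP_ennreal_eq_top_iff)
  qed
  have iii: "(SUP r\<in>{0..<1}. S3 r) = \<infinity> \<longleftrightarrow> \<not> ?B3" by (rule SUP_ennreal_eq_top_iff)
  \<comment> \<open>\<open>D1_norm_one_le\<close> asks for a constant of at least 1, hence the
    maximum with 1.\<close>
  have lin: "\<exists>C\<ge>1. \<forall>r. 0 \<le> r \<longrightarrow> r < 1 \<longrightarrow> 1 - r \<le> C * omega_hat \<omega> r" if B2: ?B2
  proof -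
    obtain C where C: "\<forall>r\<in>{0..<1}. (1 - r) / omega_hat \<omega> r \<le> C" using B2 by blast
    have "1 - r \<le> max C 1 * omega_hat \<omega> r" if r: "0 \<le> r" "r < 1" for r
    proof -
      have "(1 - r) / omega_hat \<omega> r \<le> max C 1" using C r by (auto simp: le_max_iff_disj)
      then show ?thesis using omega_hat_pos[OF assms(1) r] by (simp add: pos_divide_le_eq)
    qed
    then show ?thesis by (intro exI[of _ "max C 1"]) auto
  qed
  have "?B2 \<Longrightarrow> ?B3"
  proof -
    assume ?B2
    from lin[OF this] obtain C where "C \<ge> 1" "\<And>r. 0 \<le> r \<Longrightarrow> r < 1 \<Longrightarrow> 1 - r \<le> C * omega_hat \<omega> r" by blast
    then show ?B3
      using omega_hat_bound_imp_moment_sum_bound[OF assms(1), of C] unfolding S3_def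
      by (intro exI[of _ "4 * C"] ballI) auto
  qed
  moreover have "?B3 \<Longrightarrow> ?B2"
  proof -
    assume ?B3
    then obtain C :: real where "\<And>r. r \<in> {0..<1} \<Longrightarrow> S3 r \<le> ennreal C" by blast
    then show ?B2 unfolding S3_def by (intro moment_sum_bound_imp_omega_hat_bound[OF assms, of C]) simp
  qed
  moreover have "?B2 \<Longrightarrow> ?B4"
  proof -
    assume ?B2
    from lin[OF this] obtain C where "C \<ge> 1" "\<And>r. 0 \<le> r \<Longrightarrow> r < 1 \<Longrightarrow> 1 - r \<le> C * omega_hat \<omega> r" by blast
    then show ?B4
      using D1_norm_one_le[OF assms(1), of C] by (intro exI[of _ "4 * C"] ballI) (auto simp: D1_def)
  qed
  moreover have "?B4 \<Longrightarrow> \<not> ?const"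
  proof
    assume ?B4 and const: ?const
    then obtain C :: real where C: "\<And>f. f \<in> D1 \<omega> \<Longrightarrow> D1_norm (\<lambda>_. 1) f \<le> ennreal C * D1_norm \<omega> f" by blast
    have "ennreal (norm (Tg (\<lambda>w. w) f z)) \<le> ennreal (2 * C) * D1_norm \<omega> f" if f: "f \<in> D1 \<omega>" and z: "z \<in> ball 0 1" for f z
    proof -
      have "ennreal (norm (Tg (\<lambda>w. w) f z)) \<le> 2 * D1_norm (\<lambda>_. 1) f"
        using f z by (intro Tg_id_norm_le) (auto simp: D1_def)
      also have "\<dots> \<le> 2 * (ennreal C * D1_norm \<omega> f)" by (intro mult_left_mono C f) auto
      also have "\<dots> = ennreal (2 * C) * D1_norm \<omega> f" by (simp add: ennreal_mult' mult.assoc)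
      finally show ?thesis .
    qed
    then have "\<exists>C::real. \<forall>f\<in>D1 \<omega>. \<forall>z\<in>ball 0 1. ennreal (norm (Tg (\<lambda>w. w) f z)) \<le> ennreal C * D1_norm \<omega> f"
      by blast
    then have "(\<lambda>w. w) \<in> T_Hinf \<omega>" unfolding T_Hinf_def by (intro CollectI conjI holomorphic_intros)
    with const obtain c where c: "\<And>z. z \<in> ball (0::complex) 1 \<Longrightarrow> z = c" by blast
    have "(0::complex) = c" "(1/2::complex) = c" by (rule c, simp add: norm_divide)+
    then show False by simp
  qed
  moreover have "\<not> ?const \<Longrightarrow> ?B2"
    using T_Hinf_nonconstant_imp_bounded[OF assms] by blast
  ultimately show ?thesis unfolding ii iii[unfolded S3_def] S3_def by blast
qed

end
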